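(* Let $s\in\mathbb{N}$ and let $\mathbf{Y}=(Y_i)_{i\in\mathbb{Z}}$ be a stationary and ergodic sequence of random vectors in $\mathbb{R}^s$ with $\mathbb{E}\|Y_1\|^2<\infty$ and mean $\mu_Y=\mathbb{E}[Y_1]$. Let $(X_i)_{i\in\mathbb{N}}$ be an i.i.d. sequence of real random variables, independent of $\mathbf{Y}$, with bounded density $f$ that is continuous at $0$ with $f(0)>0$. Let $K$ be a symmetric bounded probability density on $\mathbb{R}$ with $c_2(K)=\int K^2(u)\,du<\infty$, and let $(h_n)$ be positive numbers such that $h_n\to0$, $nh_n\to\infty$ and $nh_n\,\lambda_{\max}\big(\operatorname{Cov}(\overline{\mathbf{Y}}_n)\big)\to0$ as $n\to\infty$, where $\overline{\mathbf{Y}}_n=\frac1n\sum_{i=1}^nY_i$. Define $$\widehat r_n=\frac{1}{n\,\mathbb{E}[K(X_1/h_n)]}\sum_{i=1}^n Y_i\,K\!\left(\frac{X_i}{h_n}\right)\in\mathbb{R}^s .$$ Then $$\sqrt{nh_n}\,(\widehat r_n-\mu_Y)\Rightarrow N\!\left(0,\ \frac{c_2(K)}{f(0)}\,\mathbb{E}[Y_1Y_1^\top]\right).$$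
   Context: $\Rightarrow$ denotes convergence in distribution as $n\to\infty$; $\|\cdot\|$ is the Euclidean norm; $\lambda_{\max}(A)$ is the largest eigenvalue of a symmetric matrix $A$. $N(0,\Sigma)$ may be degenerate. *)

theory Defs
  imports "HOL-Probability.Probability"
begin

definition stationary :: "'a measure \<Rightarrow> (int \<Rightarrow> 'a \<Rightarrow> 'b::topological_space) \<Rightarrow> bool" where
  "stationary M Y \<longleftrightarrow>
     (\<forall>i. Y i \<in> borel_measurable M) \<and>
     (\<forall>k. distr M (Pi\<^sub>M UNIV (\<lambda>_. borel)) (\<lambda>\<omega> i. Y (i + k) \<omega>)
        = distr M (Pi\<^sub>M UNIV (\<lambda>_. borel)) (\<lambda>\<omega> i. Y i \<omega>))"

text \<open>Ergodicity of the shift under the law of the process: every measurable shift-invariant set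
  of paths has probability 0 or 1. Meant for stationary processes.\<close>

definition ergodic :: "'a measure \<Rightarrow> (int \<Rightarrow> 'a \<Rightarrow> 'b::topological_space) \<Rightarrow> bool" where
  "ergodic M Y \<longleftrightarrow>
     (\<forall>A \<in> sets (Pi\<^sub>M UNIV (\<lambda>_::int. borel :: 'b measure)).
        (\<lambda>y i. y (i + 1)) -` A = A \<longrightarrow>
        measure M {\<omega> \<in> space M. (\<lambda>i. Y i \<omega>) \<in> A} \<in> {0, 1})"

text \<open>As the library's \<^term>\<open>prob_space.indep_var\<close>, but the two random elements may have
  different types.\<close>

definition indep_elements ::
  "'a measure \<Rightarrow> 'b measure \<Rightarrow> ('a \<Rightarrow> 'b) \<Rightarrow> 'c measure \<Rightarrow> ('a \<Rightarrow> 'c) \<Rightarrow> bool" where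
  "indep_elements M S U T V \<longleftrightarrow>
     U \<in> measurable M S \<and> V \<in> measurable M T \<and>
     prob_space.indep_set M {U -` A \<inter> space M |A. A \<in> sets S} {V -` B \<inter> space M |B. B \<in> sets T}"

definition second_moment_matrix :: "'a measure \<Rightarrow> ('a \<Rightarrow> real ^ 's) \<Rightarrow> real ^ 's ^ 's" where
  "second_moment_matrix M Z = (\<chi> i j. \<integral>\<omega>. Z \<omega> $ i * Z \<omega> $ j \<partial>M)"

definition cov_matrix :: "'a measure \<Rightarrow> ('a \<Rightarrow> real ^ 's) \<Rightarrow> real ^ 's ^ 's" where
  "cov_matrix M Z = second_moment_matrix M (\<lambda>\<omega>. Z \<omega> - (\<integral>\<omega>'. Z \<omega>' \<partial>M))"

text \<open>The set of real eigenvalues is always finite; it is nonempty when the matrix is symmetric,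
  which is the intended use.\<close>

definition lambda_max :: "real ^ 's ^ 's \<Rightarrow> real" where
  "lambda_max A = Max {c. \<exists>v. v \<noteq> 0 \<and> A *v v = c *\<^sub>R v}"

definition std_normal_vec :: "(real ^ 's) measure" where
  "std_normal_vec = density lborel (\<lambda>z. ennreal (\<Prod>i\<in>UNIV. std_normal_density (z $ i)))"

text \<open>The law of m + A Z, where Z is standard normal and A is any square matrix with
  A times its transpose equal to S. Such an A exists iff S is symmetric positive
  semidefinite, possibly singular, and the law does not depend on which A is chosen.\<close>

definition multivariate_normal :: "real ^ 's \<Rightarrow> real ^ 's ^ 's \<Rightarrow> (real ^ 's) measure" where
  "multivariate_normal m S =
     (let A = (SOME A :: real ^ 's ^ 's. A ** transpose A = S)
      in distr std_normal_vec borel (\<lambda>z. m + A *v z))"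

text \<open>Weak convergence of Borel measures; the library's \<^const>\<open>weak_conv_m\<close> covers
  only measures on the real line.\<close>

definition weakly_converges :: "(nat \<Rightarrow> 'b::topological_space measure) \<Rightarrow> 'b measure \<Rightarrow> bool" where
  "weakly_converges N_seq N \<longleftrightarrow>
     (\<forall>g :: 'b \<Rightarrow> real. continuous_on UNIV g \<and> bounded (range g) \<longrightarrow>
        (\<lambda>n. \<integral>x. g x \<partial>N_seq n) \<longlonglongrightarrow> (\<integral>x. g x \<partial>N))"

definition sample_mean :: "(int \<Rightarrow> 'a \<Rightarrow> real ^ 's) \<Rightarrow> nat \<Rightarrow> 'a \<Rightarrow> real ^ 's" where
  "sample_mean Y n \<omega> = (1 / real n) *\<^sub>R (\<Sum>i=1..n. Y (int i) \<omega>)"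

text \<open>The normalising expectation may vanish for finitely many n only (when the density of
  X 1 is continuous and positive at 0); there the value is 0 by the convention for division by 0.\<close>

definition r_hat ::
  "'a measure \<Rightarrow> (real \<Rightarrow> real) \<Rightarrow> (nat \<Rightarrow> real) \<Rightarrow> (nat \<Rightarrow> 'a \<Rightarrow> real) \<Rightarrow>
   (int \<Rightarrow> 'a \<Rightarrow> real ^ 's) \<Rightarrow> nat \<Rightarrow> 'a \<Rightarrow> real ^ 's" where
  "r_hat M K h X Y n \<omega> =
     (1 / (real n * (\<integral>\<omega>'. K (X 1 \<omega>' / h n) \<partial>M))) *\<^sub>R
     (\<Sum>i=1..n. K (X i \<omega> / h n) *\<^sub>R Y (int i) \<omega>)"

end

theory Submission
  imports Defs
begin

text \<open>
  Split \<open>r_hat - \<mu>\<close> into \<open>(n e)\<inverse> \<Sum> (K (X\<^sub>i / h) - e) Y\<^sub>i\<close> with \<open>e = E K (X\<^sub>1 / h)\<close>, plus the deviation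
  of the sample mean of \<open>Y\<close>, which after scaling tends to 0 in \<open>L\<^sup>2\<close> because its variance in
  direction \<open>t\<close> is at most \<open>\<lambda>\<^sub>m\<^sub>a\<^sub>x (norm t)\<^sup>2\<close>. Given \<open>Y\<close>, the first part is a sum of independent
  centred variables with weights \<open>\<kappa> (t \<bullet> Y\<^sub>i)\<close>, so its characteristic function is the expectation of a product of
  one-dimensional ones. Replacing each factor by \<open>exp (- a\<^sup>2 v / 2)\<close>, where \<open>a\<close> is the weight, costs
  in total at most a constant times \<open>E [(t \<bullet> Y\<^sub>1)\<^sup>2 min 1 (B \<kappa> \<bar>t \<bullet> Y\<^sub>1\<bar>)]\<close>, by stationarity, and this tends to 0 with \<open>\<kappa>\<close>.
  In the remaining exponent \<open>n\<inverse> \<Sum> (t \<bullet> Y\<^sub>i)\<^sup>2\<close> converges almost surely by Birkhoff's theorem.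
\<close>

subsection \<open>Stationary ergodic processes\<close>

text \<open>Beyond ergodicity and the eigenvalue condition nothing is known about the dependence
  inside \<open>Y\<close>, so the Gaussian fluctuations have to come from the independent
  \<open>X i\<close>. Centring the kernel weights at \<open>e\<close> makes this possible:
  \<open>Y\<close> then enters only through its sample mean and through an average of squares, for
  which a law of large numbers suffices. The scaling is
  \<open>\<kappa> = sqrt (n h) / (n e)\<close>. Here \<open>e\<close> is of order
  \<open>h f(0)\<close> and the second moment of the weight of order \<open>h f(0) c\<close>, with
  \<open>c\<close> the integral of the squared kernel. The squared mean is of order
  \<open>h^2\<close> and drops out, so \<open>n \<kappa>^2 v\<close> tends to
  \<open>c / f(0)\<close>. The weights \<open>t \<bullet> Y i\<close> are not centred, hence the
  limit carries \<open>E[Y Y^T]\<close> and not a covariance. Only two moments of \<open>Y\<close>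
  exist, so third-order Taylor errors are truncated by \<open>min 1\<close>, where \<open>B\<close>
  bounds the kernel. The limit law may be singular and have no density. Weak convergence is
  therefore obtained by smoothing the test function with a nondegenerate Gaussian, not by inverting
  characteristic functions.\<close>

lemma integral_distr_invariant:
  fixes g :: "'a \<Rightarrow> real"
  assumes T: "T \<in> measurable P P" and inv: "distr P P T = P" and g: "integrable P g"
  shows "integrable P (\<lambda>x. g (T x))" and "(\<integral>x. g (T x) \<partial>P) = (\<integral>x. g x \<partial>P)"
proof -
  have m: "g \<in> borel_measurable P" using g by simp
  have "integrable (distr P P T) g" using inv g by simp
  then show "integrable P (\<lambda>x. g (T x))"
    using integrable_distr_eq[OF T m] by simp
  show "(\<integral>x. g (T x) \<partial>P) = (\<integral>x. g x \<partial>P)"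
    using integral_distr[OF T m] inv by simp
qed

text \<open>Garsia's proof of the maximal ergodic inequality: on the invariant set where the partial
  sums are unbounded, \<open>m (Suc n) - m n \<circ> T\<close> is eventually equal to \<open>F\<close>.\<close>

lemma (in prob_space) ergodic_sums_bounded_above:
  fixes F :: "'a \<Rightarrow> real"
  assumes T[measurable]: "T \<in> measurable M M" and inv: "distr M M T = M"
    and erg: "\<And>A. A \<in> sets M \<Longrightarrow> T -` A \<inter> space M = A \<Longrightarrow> prob A \<in> {0, 1}"
    and F: "integrable M F" and neg: "(\<integral>x. F x \<partial>M) < 0"
  shows "AE x in M. \<exists>B. \<forall>n. (\<Sum>k<n. F ((T ^^ k) x)) \<le> B"
proof -
  have [measurable]: "F \<in> borel_measurable M" using F by simp
  have Tk[measurable]: "(T ^^ k) \<in> measurable M M" for k by simp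
  define S where "S n x = (\<Sum>k<n. F ((T ^^ k) x))" for n :: nat and x
  have [measurable]: "S n \<in> borel_measurable M" for n unfolding S_def by measurable
  have S0: "S 0 x = 0" for x by (simp add: S_def)
  have SSuc: "S (Suc n) x = F x + S n (T x)" for n x
    unfolding S_def by (subst sum.lessThan_Suc_shift) (simp add: funpow_swap1)
  \<comment> \<open>\<open>m n x\<close> is the maximum of \<open>S 0 x\<close>, ...,
    \<open>S n x\<close>. The recursion reflects \<open>SSuc\<close>: a nonempty sum along the orbit
    of \<open>x\<close> is \<open>F x\<close> plus a sum along the orbit of
    \<open>T x\<close>.\<close>
  define m where "m = rec_nat (\<lambda>_. 0) (\<lambda>n g x. max 0 (F x + g (T x)))"
  have m0: "m 0 x = 0" and mSuc: "m (Suc n) x = max 0 (F x + m n (T x))" for n x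
    by (simp_all add: m_def)
  have mS: "k \<le> n \<Longrightarrow> S k x \<le> m n x" for k n x
  proof (induction n arbitrary: k x)
    case 0 then show ?case by (simp add: S0 m0)
  next
    case (Suc n)
    show ?case
    proof (cases k)
      case 0 then show ?thesis by (simp add: S0 mSuc)
    next
      case (Suc j)
      then show ?thesis using Suc.IH[of j "T x"] Suc.prems by (simp add: SSuc mSuc)
    qed
  qed
  have mpos: "0 \<le> m n x" for n x by (cases n) (simp_all add: m0 mSuc)
  have mmono: "m n x \<le> m (Suc n) x" for n x
  proof (induction n arbitrary: x)
    case 0 then show ?case by (simp add: m0 mSuc)
  next
    case (Suc n)
    then show ?case by (simp only: mSuc) (smt (verit))
  qed
  have mint: "integrable M (m n)" for n
  proof (induction n)
    case 0 then show ?case by (simp add: m0)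
  next
    case (Suc n)
    have "integrable M (\<lambda>x. m n (T x))" by (rule integral_distr_invariant[OF T inv Suc])
    then have "integrable M (\<lambda>x. max 0 (F x + m n (T x)))" using F by (intro integrable_max) auto
    then show ?case by (simp add: mSuc[abs_def])
  qed
  \<comment> \<open>Bounds in the natural numbers make \<open>A\<close> a countable intersection,
    hence measurable. It is invariant because \<open>S (Suc n) x\<close> and
    \<open>S n (T x)\<close> differ by the finite number \<open>F x\<close>.\<close>
  define A where "A = {x \<in> space M. \<forall>B::nat. \<exists>n. real B < S n x}"
  have A[measurable]: "A \<in> sets M" unfolding A_def by measurable
  have TA: "T x \<in> A \<longleftrightarrow> x \<in> A" if x: "x \<in> space M" for x
  proof
    have Tx: "T x \<in> space M" using measurable_space[OF T x] .
    assume a: "T x \<in> A"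
    have "\<exists>n. real B < S n x" for B
    proof -
      obtain C :: nat where C: "real B - F x < real C" using reals_Archimedean2 by blast
      obtain n where "real C < S n (T x)" using a unfolding A_def by blast
      then have "real B < S (Suc n) x" using C by (simp add: SSuc)
      then show ?thesis by blast
    qed
    then show "x \<in> A" using x by (simp add: A_def)
  next
    have Tx: "T x \<in> space M" using measurable_space[OF T x] .
    assume a: "x \<in> A"
    have "\<exists>n. real B < S n (T x)" for B
    proof -
      obtain C :: nat where C: "real B + \<bar>F x\<bar> < real C" using reals_Archimedean2 by blast
      obtain n where n: "real C < S n x" using a unfolding A_def by blast
      then obtain j where "n = Suc j" using C by (cases n) (auto simp: S0)
      then have "real B < S j (T x)" using C n by (simp add: SSuc)
      then show ?thesis by blast
    qed
    then show "T x \<in> A" using Tx by (simp add: A_def)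
  qed
  have Ainv: "T -` A \<inter> space M = A" using TA by (auto simp: A_def)
  \<comment> \<open>Invariance of \<open>A\<close> and of the measure turns the integral of
    \<open>D n\<close> into that of \<open>m (Suc n) - m n\<close> over \<open>A\<close>, which is
    nonnegative. As \<open>m\<close> is nonnegative, \<open>\<bar>F\<bar>\<close> dominates
    \<open>D n\<close>. In the limit \<open>F\<close> has nonnegative integral over
    \<open>A\<close>, which excludes \<open>prob A = 1\<close>.\<close>
  define D where "D n x = indicator A x * m (Suc n) x - indicator A (T x) * m n (T x)" for n x
  have ie: "(indicator A (T x) :: real) = indicator A x" if "x \<in> space M" for x
    using TA[OF that] by (simp add: indicator_def)
  have imn: "integrable M (\<lambda>x. indicator A x * m n x)" for n
    using integrable_mult_indicator[OF A mint[of n]] by simp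
  have Dge: "0 \<le> (\<integral>x. D n x \<partial>M)" for n
  proof -
    have "(\<integral>x. D n x \<partial>M) = (\<integral>x. indicator A x * m (Suc n) x \<partial>M) - (\<integral>x. indicator A x * m n x \<partial>M)"
      unfolding D_def
      using integral_distr_invariant[OF T inv imn[of n]] imn[of "Suc n"] by (subst Bochner_Integration.integral_diff) auto
    also have "\<dots> \<ge> 0"
      using mmono imn by (simp add: integral_mono mult_left_mono)
    finally show ?thesis .
  qed
  have Deq: "D n x = indicator A x * max (- m n (T x)) (F x)" if "x \<in> space M" for n x
    unfolding D_def ie[OF that] mSuc by (auto simp: indicator_def)
  have "(\<lambda>n. \<integral>x. D n x \<partial>M) \<longlonglongrightarrow> (\<integral>x. indicator A x * F x \<partial>M)"
  proof (rule integral_dominated_convergence[where w = "\<lambda>x. \<bar>F x\<bar>"])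
    show "(\<lambda>x. indicator A x * F x) \<in> borel_measurable M" by measurable
    show "D n \<in> borel_measurable M" for n
      unfolding D_def[abs_def]
      using imn[of "Suc n"] integral_distr_invariant(1)[OF T inv imn[of n]]
      by (intro borel_measurable_diff borel_measurable_integrable) auto
    show "integrable M (\<lambda>x. \<bar>F x\<bar>)" using F by simp
    show "AE x in M. norm (D n x) \<le> \<bar>F x\<bar>" for n
    proof (rule AE_I2)
      fix x assume x: "x \<in> space M"
      show "norm (D n x) \<le> \<bar>F x\<bar>"
        unfolding Deq[OF x] using mpos[of n "T x"] by (auto simp: indicator_def)
    qed
    show "AE x in M. (\<lambda>n. D n x) \<longlonglongrightarrow> indicator A x * F x"
    proof (rule AE_I2)
      fix x assume x: "x \<in> space M"
      show "(\<lambda>n. D n x) \<longlonglongrightarrow> indicator A x * F x"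
      proof (cases "x \<in> A")
        case False then show ?thesis unfolding Deq[OF x] by simp
      next
        case True
        then have "T x \<in> A" using TA[OF x] by simp
        obtain C :: nat where C: "- F x < real C" using reals_Archimedean2 by blast
        obtain N where N: "real C < S N (T x)" using \<open>T x \<in> A\<close> unfolding A_def by blast
        have "D n x = F x" if "n \<ge> N" for n
          unfolding Deq[OF x] using True mS[OF that, of "T x"] N C by (auto simp: indicator_def)
        then have "eventually (\<lambda>n. D n x = F x) sequentially"
          using eventually_sequentially by blast
        then show ?thesis using True by (simp add: tendsto_eventually)
      qed
    qed
  qed
  then have "0 \<le> (\<integral>x. indicator A x * F x \<partial>M)"
    by (rule LIMSEQ_le_const) (use Dge in auto)
  then have "prob A \<noteq> 1"
  proof (rule contrapos_pn)
    assume "prob A = 1"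
    then have "AE x in M. x \<in> A" using A by (simp add: prob_eq_1)
    then have "(\<integral>x. indicator A x * F x \<partial>M) = (\<integral>x. F x \<partial>M)"
      by (intro integral_cong_AE) auto
    then show "\<not> 0 \<le> (\<integral>x. indicator A x * F x \<partial>M)" using neg by simp
  qed
  then have "prob A = 0" using erg[OF A Ainv] by simp
  then have "AE x in M. x \<notin> A" using A by (simp add: prob_eq_0)
  then show ?thesis
  proof (rule AE_mp, intro AE_I2 impI)
    fix x assume x: "x \<in> space M" and "x \<notin> A"
    then obtain B :: nat where "\<forall>n. S n x \<le> real B" by (auto simp: A_def not_less)
    then show "\<exists>B. \<forall>n. (\<Sum>k<n. F ((T ^^ k) x)) \<le> B" unfolding S_def by blast
  qed
qed

text \<open>Lowering \<open>F - E F\<close> and \<open>E F - F\<close> by \<open>1 / Suc j\<close>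
  makes their integrals negative, so their partial sums are bounded above almost surely. Division by
  \<open>n\<close> leaves a deviation of at most \<open>1 / Suc j\<close> in the limit, and
  countably many \<open>j\<close> cost only one null set.\<close>

theorem (in prob_space) birkhoff_ergodic:
  fixes F :: "'a \<Rightarrow> real"
  assumes T: "T \<in> measurable M M" and inv: "distr M M T = M"
    and erg: "\<And>A. A \<in> sets M \<Longrightarrow> T -` A \<inter> space M = A \<Longrightarrow> prob A \<in> {0, 1}"
    and F: "integrable M F"
  shows "AE x in M. (\<lambda>n. (\<Sum>k<n. F ((T ^^ k) x)) / real n) \<longlonglongrightarrow> (\<integral>x. F x \<partial>M)"
proof -
  let ?E = "\<integral>x. F x \<partial>M"
  have "AE x in M. \<forall>j. \<exists>B. \<forall>n. (\<Sum>k<n. F ((T ^^ k) x) - ?E - 1 / real (Suc j)) \<le> B"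
  proof (subst AE_all_countable, rule allI)
    fix j show "AE x in M. \<exists>B. \<forall>n. (\<Sum>k<n. F ((T ^^ k) x) - ?E - 1 / real (Suc j)) \<le> B"
      by (rule ergodic_sums_bounded_above[OF T inv erg]) (use F prob_space in simp_all)
  qed
  moreover have "AE x in M. \<forall>j. \<exists>B. \<forall>n. (\<Sum>k<n. ?E - F ((T ^^ k) x) - 1 / real (Suc j)) \<le> B"
  proof (subst AE_all_countable, rule allI)
    fix j show "AE x in M. \<exists>B. \<forall>n. (\<Sum>k<n. ?E - F ((T ^^ k) x) - 1 / real (Suc j)) \<le> B"
      by (rule ergodic_sums_bounded_above[OF T inv erg]) (use F prob_space in simp_all)
  qed
  ultimately show ?thesis
  proof eventually_elim
    case (elim x)
    show ?case
    proof (rule LIMSEQ_I)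
      fix r :: real assume "0 < r"
      then obtain j where j: "1 / real (Suc j) < r / 2"
        using nat_approx_posE[of "r / 2"] by auto
      obtain B1 where B1: "\<And>n. (\<Sum>k<n. F ((T ^^ k) x) - ?E - 1 / real (Suc j)) \<le> B1"
        using elim(1) by blast
      obtain B2 where B2: "\<And>n. (\<Sum>k<n. ?E - F ((T ^^ k) x) - 1 / real (Suc j)) \<le> B2"
        using elim(2) by blast
      define B where "B = max B1 B2"
      obtain N :: nat where N: "B / (r / 2) < real N" using reals_Archimedean2 by blast
      have "norm ((\<Sum>k<n. F ((T ^^ k) x)) / real n - ?E) < r" if n: "n \<ge> Suc N" for n
      proof -
        let ?S = "\<Sum>k<n. F ((T ^^ k) x)"
        have n0: "0 < real n" using n by simp
        have "B < real n * (r / 2)"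
          using N n \<open>0 < r\<close> by (simp add: pos_divide_less_eq) (smt (verit) mult_right_mono of_nat_mono Suc_leD)
        moreover have "?S - real n * ?E - real n * (1 / real (Suc j)) \<le> B"
          using B1[of n] by (simp add: sum_subtractf B_def)
        moreover have "real n * ?E - ?S - real n * (1 / real (Suc j)) \<le> B"
          using B2[of n] by (simp add: sum_subtractf B_def)
        moreover have "real n * (1 / real (Suc j)) < real n * (r / 2)" using j n0 by (rule mult_strict_left_mono)
        moreover have "real n * (r / 2) + real n * (r / 2) = real n * r" by simp
        ultimately have "\<bar>?S - real n * ?E\<bar> < real n * r" by linarith
        moreover have "?S / real n - ?E = (?S - real n * ?E) / real n" using n0 by (simp add: field_simps)
        ultimately show ?thesis using n0 by (simp add: pos_divide_less_eq mult.commute)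
      qed
      then show "\<exists>no. \<forall>n\<ge>no. norm ((\<Sum>k<n. F ((T ^^ k) x)) / real n - ?E) < r" by blast
    qed
  qed
qed

text \<open>Both hypotheses on \<open>Y\<close> concern the law of its path, so the ergodic theorem
  is applied to the shift on path space under that law and then pulled back. That space is all of
  \<open>UNIV\<close>, so invariance there is exactly the condition in
  \<open>ergodic\<close>.\<close>

lemma stationary_ergodic_average:
  fixes \<phi> :: "'b::topological_space \<Rightarrow> real"
  assumes M: "prob_space M" and stat: "stationary M Y" and erg: "ergodic M Y"
    and \<phi>[measurable]: "\<phi> \<in> borel_measurable borel" and int: "integrable M (\<lambda>\<omega>. \<phi> (Y 1 \<omega>))"
  shows "AE \<omega> in M. (\<lambda>n. (\<Sum>i=1..n. \<phi> (Y (int i) \<omega>)) / real n) \<longlonglongrightarrow> (\<integral>\<omega>. \<phi> (Y 1 \<omega>) \<partial>M)"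
proof -
  interpret prob_space M by fact
  let ?Q = "Pi\<^sub>M UNIV (\<lambda>_::int. borel :: 'b measure)"
  have Y[measurable]: "Y i \<in> borel_measurable M" for i using stat by (simp add: stationary_def)
  let ?Y = "\<lambda>\<omega> i. Y i \<omega>"
  have V[measurable]: "?Y \<in> measurable M ?Q" by (rule measurable_PiM_single') auto
  define P where "P = distr M ?Q ?Y"
  have setsP[simp, measurable_cong]: "sets P = sets ?Q" by (simp add: P_def)
  have spP: "space P = UNIV" by (simp add: P_def space_PiM)
  interpret P: prob_space P unfolding P_def by (rule prob_space_distr) (rule V)
  define T where "T y = (\<lambda>i. y (i + 1))" for y :: "int \<Rightarrow> 'b"
  have TQ[measurable]: "T \<in> measurable ?Q ?Q"
    unfolding T_def by (rule measurable_PiM_single') (auto simp: space_PiM)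
  have TP: "T \<in> measurable P P" by (simp add: measurable_cong_sets[OF setsP setsP])
  have inv: "distr P P T = P"
  proof -
    have "distr P P T = distr M ?Q (T \<circ> ?Y)"
      unfolding P_def by (subst distr_cong[OF refl sets_distr refl], subst distr_distr) auto
    also have "\<dots> = P" using stat unfolding stationary_def P_def T_def comp_def by blast
    finally show ?thesis .
  qed
  have Tk: "(T ^^ k) y = (\<lambda>i. y (i + int k))" for k y
    by (induction k arbitrary: y) (auto simp: T_def funpow_swap1 add_ac)
  have erg': "P.prob A \<in> {0, 1}" if "A \<in> sets P" "T -` A \<inter> space P = A" for A
  proof -
    have "A \<in> sets ?Q" using that(1) by simp
    moreover have "(\<lambda>y i. y (i + 1)) -` A = A" using that(2) by (simp add: spP T_def[abs_def])
    ultimately have "measure M {\<omega> \<in> space M. ?Y \<omega> \<in> A} \<in> {0, 1}"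
      using erg unfolding ergodic_def by blast
    moreover have "P.prob A = measure M {\<omega> \<in> space M. ?Y \<omega> \<in> A}"
      unfolding P_def using \<open>A \<in> sets ?Q\<close>
      by (subst measure_distr[OF V]) (auto intro!: arg_cong[where f = "measure M"])
    ultimately show ?thesis by simp
  qed
  have Fm: "(\<lambda>y. \<phi> (y 1)) \<in> borel_measurable ?Q" by measurable
  have intP: "integrable P (\<lambda>y. \<phi> (y 1))"
    unfolding P_def using int by (subst integrable_distr_eq[OF V Fm])
  have "AE y in P. (\<lambda>n. (\<Sum>k<n. \<phi> ((T ^^ k) y 1)) / real n) \<longlonglongrightarrow> (\<integral>y. \<phi> (y 1) \<partial>P)"
    by (rule P.birkhoff_ergodic[OF TP inv erg' intP])
  also have "(\<integral>y. \<phi> (y 1) \<partial>P) = (\<integral>\<omega>. \<phi> (Y 1 \<omega>) \<partial>M)"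
    unfolding P_def by (subst integral_distr[OF V Fm]) simp
  finally have "AE \<omega> in M. (\<lambda>n. (\<Sum>k<n. \<phi> ((T ^^ k) (?Y \<omega>) 1)) / real n) \<longlonglongrightarrow> (\<integral>\<omega>. \<phi> (Y 1 \<omega>) \<partial>M)"
    unfolding P_def by (rule AE_distrD[OF V])
  \<comment> \<open>Coordinate 1 of the path shifted \<open>k\<close> times is
    \<open>Y (1 + k)\<close>, so \<open>k < n\<close> covers the indices 1 to
    \<open>n\<close>.\<close>
  moreover have "(\<Sum>k<n. \<phi> ((T ^^ k) (?Y \<omega>) 1)) = (\<Sum>i=1..n. \<phi> (Y (int i) \<omega>))" for n \<omega>
    unfolding Tk by (rule sum.reindex_bij_witness[of _ "\<lambda>i. i - 1" Suc]) auto
  ultimately show ?thesis by simp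
qed

lemma stationary_integral:
  fixes \<phi> :: "'b::topological_space \<Rightarrow> 'c::{banach, second_countable_topology}"
  assumes stat: "stationary M Y" and \<phi>[measurable]: "\<phi> \<in> borel_measurable borel"
  shows "(\<integral>\<omega>. \<phi> (Y i \<omega>) \<partial>M) = (\<integral>\<omega>. \<phi> (Y j \<omega>) \<partial>M)"
    and "integrable M (\<lambda>\<omega>. \<phi> (Y i \<omega>)) \<longleftrightarrow> integrable M (\<lambda>\<omega>. \<phi> (Y j \<omega>))"
proof -
  let ?Q = "Pi\<^sub>M UNIV (\<lambda>_::int. borel :: 'b measure)"
  have Y[measurable]: "Y i \<in> borel_measurable M" for i using stat by (simp add: stationary_def)
  have V: "(\<lambda>\<omega> i. Y (i + k) \<omega>) \<in> measurable M ?Q" for k by (rule measurable_PiM_single') auto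
  \<comment> \<open>The shift by \<open>i - j\<close> puts \<open>Y i\<close> at coordinate
    \<open>j\<close>; one functional of coordinate \<open>j\<close> then yields both
    integrals.\<close>
  have e: "distr M ?Q (\<lambda>\<omega> l. Y (l + (i - j)) \<omega>) = distr M ?Q (\<lambda>\<omega> l. Y (l + 0) \<omega>)"
    using stat by (simp add: stationary_def)
  have Fm: "(\<lambda>y. \<phi> (y j)) \<in> borel_measurable ?Q" by measurable
  show "(\<integral>\<omega>. \<phi> (Y i \<omega>) \<partial>M) = (\<integral>\<omega>. \<phi> (Y j \<omega>) \<partial>M)"
    using arg_cong[OF e, of "\<lambda>P. \<integral>y. \<phi> (y j) \<partial>P"] unfolding integral_distr[OF V Fm] by simp
  show "integrable M (\<lambda>\<omega>. \<phi> (Y i \<omega>)) \<longleftrightarrow> integrable M (\<lambda>\<omega>. \<phi> (Y j \<omega>))"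
    using arg_cong[OF e, of "\<lambda>P. integrable P (\<lambda>y. \<phi> (y j))"] unfolding integrable_distr_eq[OF V Fm] by simp
qed

subsection \<open>Symmetric matrices\<close>

text \<open>With a zero diagonal entry at \<open>j\<close>, the quadratic form along
  \<open>e_i + c e_j\<close> is affine in \<open>c\<close> with slope \<open>2 S_ij\<close>. A
  nonzero slope would make it negative somewhere; the chosen \<open>c\<close> gives the value
  -1.\<close>

lemma cross_entry_zero_of_psd:
  fixes S :: "real ^ 'n ^ 'n"
  assumes sym: "transpose S = S" and psd: "\<And>x. 0 \<le> x \<bullet> (S *v x)" and z: "S $ j $ j = 0"
  shows "S $ i $ j = 0"
proof (rule ccontr)
  assume ne: "S $ i $ j \<noteq> 0"
  have sij: "S $ j $ i = S $ i $ j" using sym by (metis transpose_def vec_lambda_beta)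
  define c where "c = - (S $ i $ i + 1) / (2 * S $ i $ j)"
  let ?x = "axis i 1 + c *\<^sub>R axis j 1 :: real ^ 'n"
  have col: "(S *v axis k 1) $ l = S $ l $ k" for k l
    by (simp add: matrix_vector_mult_basis column_def)
  have ax: "axis k (1::real) \<bullet> v = v $ k" for k and v :: "real ^ 'n"
    by (simp add: inner_axis')
  have "?x \<bullet> (S *v ?x) = S $ i $ i + 2 * c * S $ i $ j"
    by (simp add: matrix_vector_right_distrib matrix_vector_mult_scaleR inner_add_left inner_add_right
        ax col z sij)
  also have "\<dots> = -1" using ne by (simp add: c_def field_simps)
  finally show False using psd[of ?x] by simp
qed

text \<open>Cholesky elimination: subtracting \<open>u u\<^sup>T\<close> with \<open>u = S e\<^sub>i / sqrt S\<^sub>i\<^sub>i\<close> clears row and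
  column \<open>i\<close> and keeps the matrix positive semidefinite.\<close>

lemma psd_factorization_supported:
  fixes S :: "real ^ 'n ^ 'n"
  assumes "finite I" and "transpose S = S" and "\<And>x. 0 \<le> x \<bullet> (S *v x)"
    and "\<And>j. j \<notin> I \<Longrightarrow> S $ j $ j = 0"
  shows "\<exists>A :: real ^ 'n ^ 'n. A ** transpose A = S \<and> (\<forall>j. j \<notin> I \<longrightarrow> (\<forall>i. A $ i $ j = 0))"
  using assms
proof (induction I arbitrary: S rule: finite_induct)
  case empty
  have "S = 0" using cross_entry_zero_of_psd[OF empty(1,2)] empty(3) by (simp add: vec_eq_iff)
  then show ?case by (intro exI[of _ 0]) (simp add: matrix_matrix_mult_def vec_eq_iff)
next
  case (insert p I S)
  have sij: "S $ j $ i = S $ i $ j" for i j using insert.prems(1) by (metis transpose_def vec_lambda_beta)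
  show ?case
  proof (cases "S $ p $ p = 0")
    case True
    then show ?thesis using insert.IH[OF insert.prems(1,2)] insert.prems(3) by (metis insert_iff)
  next
    case False
    have Sv: "(S *v x) $ i = (\<Sum>j\<in>UNIV. S $ i $ j * x $ j)" for x i
      by (simp add: matrix_vector_mult_def)
    have spp: "S $ p $ p > 0"
    proof -
      have "axis p 1 \<bullet> (S *v axis p 1) = S $ p $ p"
        by (simp add: inner_axis' matrix_vector_mult_basis column_def)
      then show ?thesis using insert.prems(2)[of "axis p 1"] False by simp
    qed
    define s where "s = S $ p $ p"
    define u where "u i = S $ i $ p / sqrt s" for i
    have s0: "0 < s" using spp by (simp add: s_def)
    have uu: "u i * u j = S $ i $ p * S $ j $ p / s" for i j using s0 by (simp add: u_def)
    define S' where "S' = (\<chi> i j. S $ i $ j - u i * u j)"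
    have S'v: "(S' *v x) $ i = (S *v x) $ i - u i * (\<Sum>j\<in>UNIV. u j * x $ j)" for x i
      by (simp add: S'_def matrix_vector_mult_def left_diff_distrib sum_subtractf sum_distrib_left mult.assoc)
    have q': "x \<bullet> (S' *v x) = x \<bullet> (S *v x) - (\<Sum>j\<in>UNIV. u j * x $ j)\<^sup>2" for x
      by (simp add: inner_vec_def S'v right_diff_distrib sum_subtractf sum_distrib_right power2_eq_square mult_ac)
    have sym': "transpose S' = S'" by (simp add: transpose_def S'_def vec_eq_iff sij mult.commute)
    have psd': "0 \<le> x \<bullet> (S' *v x)" for x
    proof -
      let ?l = "\<Sum>j\<in>UNIV. u j * x $ j"
      have l: "?l = (S *v x) $ p / sqrt s"
        by (simp only: u_def Sv sum_divide_distrib sij[of _ p]) simp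
      \<comment> \<open>This \<open>c\<close> minimises the form of \<open>S\<close> along the line
        through \<open>x\<close> in direction \<open>e_p\<close>. The minimum is exactly the form of
        \<open>S'\<close> at \<open>x\<close>, so \<open>S'\<close> inherits nonnegativity.\<close>
      define c where "c = - ((S *v x) $ p / s)"
      let ?y = "x + c *\<^sub>R axis p 1"
      have ax: "x \<bullet> (S *v axis p 1) = (S *v x) $ p"
        unfolding Sv by (auto simp: inner_vec_def matrix_vector_mult_basis column_def sij[of p]
            mult.commute intro!: sum.cong)
      have "?y \<bullet> (S *v ?y) = x \<bullet> (S *v x) + 2 * c * (S *v x) $ p + c\<^sup>2 * s"
        by (simp add: matrix_vector_right_distrib matrix_vector_mult_scaleR inner_add_left inner_add_right
          ax inner_axis' s_def power2_eq_square)
          (simp add: matrix_vector_mult_basis column_def algebra_simps)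
      also have "\<dots> = x \<bullet> (S *v x) - ?l\<^sup>2"
        using s0 by (simp add: c_def l power2_eq_square field_simps)
      finally show ?thesis using insert.prems(2)[of ?y] q' by simp
    qed
    have diag': "S' $ j $ j = 0" if "j \<notin> I" for j
    proof (cases "j = p")
      case True then show ?thesis using s0 by (simp add: S'_def uu) (simp add: s_def)
    next
      case False
      then have z: "S $ j $ j = 0" using insert.prems(3) that by simp
      then have "S $ p $ j = 0" using cross_entry_zero_of_psd[OF insert.prems(1,2)] by blast
      then have "S $ j $ p = 0" by (simp only: sij[of j p])
      then show ?thesis using z by (simp add: S'_def u_def)
    qed
    obtain A :: "real ^ 'n ^ 'n" where A: "A ** transpose A = S'" "\<And>i j. j \<notin> I \<Longrightarrow> A $ i $ j = 0"
      using insert.IH[OF sym' psd' diag'] by auto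
    \<comment> \<open>Column \<open>p\<close> of \<open>A\<close> vanishes because \<open>p\<close>
      is not in \<open>I\<close>, so putting \<open>u\<close> there adds precisely
      \<open>u u^T\<close> to the product. Keeping this column free is the purpose of the support
      clause in the induction.\<close>
    define B :: "real ^ 'n ^ 'n" where "B = (\<chi> i j. if j = p then u i else A $ i $ j)"
    have "(B ** transpose B) $ i $ j = S $ i $ j" for i j
    proof -
      have "(B ** transpose B) $ i $ j = (\<Sum>k\<in>UNIV. (if k = p then u i * u j else 0) + A $ i $ k * A $ j $ k)"
        using A(2)[OF insert.hyps(2)]
        by (simp add: matrix_matrix_mult_def transpose_def B_def) (auto intro!: sum.cong)
      also have "\<dots> = u i * u j + (A ** transpose A) $ i $ j"
        by (simp add: sum.distrib matrix_matrix_mult_def transpose_def)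
      also have "\<dots> = S $ i $ j" by (simp add: A(1) S'_def)
      finally show ?thesis .
    qed
    then have "B ** transpose B = S" by (simp add: vec_eq_iff)
    moreover have "\<forall>j. j \<notin> insert p I \<longrightarrow> (\<forall>i. B $ i $ j = 0)" using A(2) by (simp add: B_def)
    ultimately show ?thesis by blast
  qed
qed

lemma psd_factorization:
  fixes S :: "real ^ 'n ^ 'n"
  assumes "transpose S = S" and "\<And>x. 0 \<le> x \<bullet> (S *v x)"
  shows "\<exists>A :: real ^ 'n ^ 'n. A ** transpose A = S"
proof -
  obtain A :: "real ^ 'n ^ 'n" where "A ** transpose A = S"
    using psd_factorization_supported[of UNIV S, OF finite_class.finite_UNIV assms] by blast
  then show ?thesis by blast
qed

lemma inner_symmetric_matrix:
  fixes A :: "real ^ 'n ^ 'n"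
  assumes "transpose A = A"
  shows "x \<bullet> (A *v y) = (A *v x) \<bullet> y"
proof -
  have "x \<bullet> (A *v y) = (x v* transpose A) \<bullet> y" unfolding assms by (rule dot_lmul_matrix[symmetric])
  then show ?thesis by (simp only: vector_transpose_matrix)
qed

text \<open>Eigenvectors of distinct eigenvalues are orthogonal and nonzero, and a pairwise
  orthogonal set in finite dimension is finite. Finiteness makes the \<open>Max\<close> in
  \<open>lambda_max\<close> an upper bound.\<close>

lemma finite_eigenvalues_symmetric:
  fixes A :: "real ^ 'n ^ 'n"
  assumes sym: "transpose A = A"
  shows "finite {c. \<exists>v. v \<noteq> 0 \<and> A *v v = c *\<^sub>R v}" (is "finite ?E")
proof -
  define v where "v c = (SOME v. v \<noteq> 0 \<and> A *v v = c *\<^sub>R v)" for c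
  have v: "v c \<noteq> 0 \<and> A *v v c = c *\<^sub>R v c" if "c \<in> ?E" for c
    unfolding v_def by (rule someI_ex) (use that in simp)
  have orth: "orthogonal (v c) (v d)" if "c \<in> ?E" "d \<in> ?E" "c \<noteq> d" for c d
  proof -
    have "d * (v c \<bullet> v d) = v c \<bullet> (A *v v d)" using v[OF that(2)] by simp
    also have "\<dots> = (A *v v c) \<bullet> v d" by (rule inner_symmetric_matrix[OF sym])
    also have "\<dots> = c * (v c \<bullet> v d)" using v[OF that(1)] by simp
    finally show ?thesis using that(3) by (simp add: orthogonal_def)
  qed
  have inj: "inj_on v ?E"
  proof (rule inj_onI, rule ccontr)
    fix c d assume cd: "c \<in> ?E" "d \<in> ?E" "v c = v d" "c \<noteq> d"
    show False using orth[OF cd(1,2,4)] v[OF cd(2)] cd(3) by (simp add: orthogonal_self)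
  qed
  have "pairwise orthogonal (v ` ?E)"
    using orth by (force simp: pairwise_def)
  then have "finite (v ` ?E)" by (rule pairwise_orthogonal_imp_finite)
  then show ?thesis using inj finite_imageD by blast
qed

text \<open>The form attains its maximum \<open>c\<close> on the compact unit sphere. A maximiser is
  an eigenvector with eigenvalue \<open>c\<close>, so \<open>c\<close> is among the numbers over
  which \<open>lambda_max\<close> is taken.\<close>

lemma quadratic_form_le_lambda_max:
  fixes A :: "real ^ 'n ^ 'n"
  assumes sym: "transpose A = A"
  shows "x \<bullet> (A *v x) \<le> lambda_max A * (norm x)\<^sup>2"
proof -
  let ?q = "\<lambda>x. x \<bullet> (A *v x)"
  let ?S = "sphere (0 :: real ^ 'n) 1"
  have "axis undefined 1 \<in> ?S" by simp
  then have "?S \<noteq> {}" by blast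
  moreover have "continuous_on ?S ?q"
    by (intro continuous_intros linear_continuous_on matrix_vector_mul_bounded_linear)
  ultimately obtain v where v: "v \<in> ?S" "\<And>x. x \<in> ?S \<Longrightarrow> ?q x \<le> ?q v"
    using continuous_attains_sup[OF compact_sphere] by blast
  define c where "c = ?q v"
  have nv: "norm v = 1" using v(1) by simp
  have le: "?q x \<le> c * (norm x)\<^sup>2" for x
  proof (cases "x = 0")
    case False
    let ?y = "(1 / norm x) *\<^sub>R x"
    have "?y \<in> ?S" using False by simp
    then have "?q ?y \<le> c" unfolding c_def by (rule v(2))
    moreover have "?q ?y = ?q x / (norm x)\<^sup>2"
      by (simp only: matrix_vector_mult_scaleR inner_scaleR_left inner_scaleR_right)
         (simp add: power2_eq_square)
    ultimately have "?q x / (norm x)\<^sup>2 \<le> c" by simp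
    then show ?thesis using False by (simp add: divide_le_eq)
  qed simp
  text \<open>The first variation of the Rayleigh quotient at its maximum in the direction of the
    residual \<open>w\<close> forces \<open>w = 0\<close>.\<close>
  define w where "w = A *v v - c *\<^sub>R v"
  have "w = 0"
  proof (rule ccontr)
    assume "w \<noteq> 0"
    then have w0: "0 < w \<bullet> w" by simp
    have vw: "v \<bullet> w = 0"
      using nv by (simp add: w_def inner_diff_right c_def norm_eq_1)
    have wAv: "w \<bullet> (A *v v) = w \<bullet> w"
    proof -
      have "A *v v = w + c *\<^sub>R v" by (simp add: w_def)
      then show ?thesis using vw by (simp add: inner_add_right inner_commute)
    qed
    \<comment> \<open>\<open>K\<close> bounds the second-order coefficient of the perturbation. With
      step \<open>e = (w \<bullet> w) / K\<close>, the second-order term cancels at most half of the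
      first-order gain \<open>2 (w \<bullet> w)\<close>, so the maximum would be exceeded.\<close>
    define K where "K = \<bar>?q w - c * (w \<bullet> w)\<bar> + 1"
    define e where "e = (w \<bullet> w) / K"
    have K0: "0 < K" by (simp add: K_def)
    have e0: "0 < e" using w0 K0 by (simp add: e_def)
    have "?q (v + e *\<^sub>R w) = c + 2 * e * (w \<bullet> w) + e\<^sup>2 * ?q w"
      using wAv inner_symmetric_matrix[OF sym, of v w]
      by (simp add: matrix_vector_right_distrib matrix_vector_mult_scaleR inner_add_left inner_add_right
          c_def power2_eq_square inner_commute algebra_simps)
    moreover have "(norm (v + e *\<^sub>R w))\<^sup>2 = 1 + e\<^sup>2 * (w \<bullet> w)"
      using vw nv by (simp only: power2_norm_eq_inner)
         (simp add: inner_add_left inner_add_right norm_eq_1 power2_eq_square inner_commute)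
    ultimately have "2 * e * (w \<bullet> w) + e\<^sup>2 * (?q w - c * (w \<bullet> w)) \<le> 0"
      using le[of "v + e *\<^sub>R w"] by (simp add: algebra_simps)
    then have "e * (2 * (w \<bullet> w) + e * (?q w - c * (w \<bullet> w))) \<le> 0"
      by (simp add: algebra_simps power2_eq_square)
    then have "2 * (w \<bullet> w) + e * (?q w - c * (w \<bullet> w)) \<le> 0"
      using e0 by (simp add: mult_le_0_iff)
    moreover have "e * (?q w - c * (w \<bullet> w)) \<ge> - (e * K)"
    proof -
      have "?q w - c * (w \<bullet> w) \<ge> - K" unfolding K_def by linarith
      then have "e * (?q w - c * (w \<bullet> w)) \<ge> e * (- K)" using e0 by (intro mult_left_mono) auto
      then show ?thesis by simp
    qed
    moreover have "e * K = w \<bullet> w" using K0 by (simp add: e_def)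
    ultimately show False using w0 by linarith
  qed
  then have "A *v v = c *\<^sub>R v" by (simp add: w_def)
  moreover have "v \<noteq> 0" using nv by auto
  ultimately have "c \<le> lambda_max A"
    unfolding lambda_max_def by (intro Max_ge finite_eigenvalues_symmetric[OF sym]) blast
  then show ?thesis using le[of x] mult_right_mono[of c "lambda_max A" "(norm x)\<^sup>2"] by simp
qed

subsection \<open>Characteristic functions and weak convergence\<close>

text \<open>Lebesgue measure is a product over \<open>Basis\<close>, which for vectors is the range
  of \<open>axis\<close>. Reindexing along this injection reduces both claims to the product
  integral theorems.\<close>

lemma
  fixes f :: "'n::finite \<Rightarrow> real \<Rightarrow> 'b::{real_normed_field, banach, second_countable_topology}"
  assumes f: "\<And>i. integrable lborel (f i)"
  shows integrable_lborel_vec_prod: "integrable lborel (\<lambda>z :: real ^ 'n. \<Prod>i\<in>UNIV. f i (z $ i))"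
    and integral_lborel_vec_prod:
      "(\<integral>z. (\<Prod>i\<in>UNIV. f i (z $ i)) \<partial>(lborel :: (real ^ 'n) measure)) = (\<Prod>i\<in>UNIV. \<integral>x. f i x \<partial>lborel)"
proof -
  interpret product_sigma_finite "\<lambda>b :: real ^ 'n. lborel :: real measure" ..
  let ?ax = "\<lambda>i. axis i 1 :: real ^ 'n"
  let ?T = "\<lambda>w. \<Sum>b\<in>Basis. w b *\<^sub>R b :: real ^ 'n"
  have inj: "inj ?ax" by (auto simp: inj_def axis_eq_axis)
  have B: "Basis = range ?ax" by (auto simp: Basis_vec_def)
  define g where "g b = f (inv ?ax b)" for b
  have gax: "g (?ax i) = f i" for i by (simp add: g_def inv_f_f[OF inj])
  have nth: "?T w $ i = w (?ax i)" for w i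
  proof -
    have "?T w $ i = ?T w \<bullet> ?ax i" by (simp add: inner_axis)
    also have "\<dots> = w (?ax i)" by (rule inner_sum_left_Basis) (simp add: B)
    finally show ?thesis .
  qed
  have eq: "(\<Prod>i\<in>UNIV. f i (?T w $ i)) = (\<Prod>b\<in>Basis. g b (w b))" for w
    by (simp only: nth) (simp add: B prod.reindex[OF inj] gax)
  have [measurable]: "f i \<in> borel_measurable borel" for i using f[of i] by simp
  have ig: "integrable lborel (g b)" if "b \<in> Basis" for b using that f by (auto simp: B gax)
  have T: "?T \<in> measurable (\<Pi>\<^sub>M b\<in>Basis. lborel) borel" by measurable
  have m: "(\<lambda>z :: real ^ 'n. \<Prod>i\<in>UNIV. f i (z $ i)) \<in> borel_measurable borel" by measurable
  show "integrable lborel (\<lambda>z :: real ^ 'n. \<Prod>i\<in>UNIV. f i (z $ i))"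
    by (subst lborel_eq, subst integrable_distr_eq[OF T m])
       (unfold eq, intro product_integrable_prod ig, auto)
  have "(\<integral>z. (\<Prod>i\<in>UNIV. f i (z $ i)) \<partial>(lborel :: (real ^ 'n) measure))
      = (\<integral>w. (\<Prod>b\<in>Basis. g b (w b)) \<partial>(\<Pi>\<^sub>M b\<in>Basis. lborel))"
    by (subst lborel_eq, subst integral_distr[OF T m]) (unfold eq, rule refl)
  also have "\<dots> = (\<Prod>b\<in>Basis. \<integral>x. g b x \<partial>lborel)"
    by (rule product_integral_prod) (auto intro: ig)
  also have "\<dots> = (\<Prod>i\<in>UNIV. \<integral>x. f i x \<partial>lborel)"
    unfolding B by (subst prod.reindex[OF inj]) (simp add: gax)
  finally show "(\<integral>z. (\<Prod>i\<in>UNIV. f i (z $ i)) \<partial>(lborel :: (real ^ 'n) measure)) = (\<Prod>i\<in>UNIV. \<integral>x. f i x \<partial>lborel)" .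
qed

lemma sets_std_normal_vec [simp, measurable_cong]: "sets std_normal_vec = sets borel"
  by (simp add: std_normal_vec_def)

lemma space_std_normal_vec [simp]: "space std_normal_vec = UNIV"
  by (simp add: std_normal_vec_def)

lemma prob_space_std_normal_vec: "prob_space (std_normal_vec :: (real ^ 'n) measure)"
proof
  have i: "integrable lborel (\<lambda>z :: real ^ 'n. \<Prod>i\<in>UNIV. std_normal_density (z $ i))"
    by (intro integrable_lborel_vec_prod integrable_normal_density) simp
  have "emeasure std_normal_vec (space std_normal_vec :: (real ^ 'n) set)
      = (\<integral>\<^sup>+z. ennreal (\<Prod>i\<in>UNIV. std_normal_density ((z :: real ^ 'n) $ i)) \<partial>lborel)"
    by (simp add: std_normal_vec_def emeasure_density)
  also have "\<dots> = ennreal (\<integral>z. (\<Prod>i\<in>UNIV. std_normal_density (z $ i)) \<partial>(lborel :: (real ^ 'n) measure))"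
    by (intro nn_integral_eq_integral i) (simp add: prod_nonneg)
  also have "\<dots> = 1"
    by (subst integral_lborel_vec_prod) (simp_all add: integrable_normal_density integral_normal_density)
  finally show "emeasure std_normal_vec (space std_normal_vec :: (real ^ 'n) set) = 1" .
qed

definition char_vec :: "'b::euclidean_space measure \<Rightarrow> 'b \<Rightarrow> complex" where
  "char_vec M t = (CLINT x|M. iexp (t \<bullet> x))"

lemma iexp_inner_vec: "iexp (t \<bullet> z) = (\<Prod>i\<in>UNIV. iexp (t $ i * z $ i))" for t z :: "real ^ 'n"
  by (simp add: inner_vec_def sum_distrib_left exp_sum)

lemma norm_vec_power2: "(norm z)\<^sup>2 = (\<Sum>i\<in>UNIV. (z $ i)\<^sup>2)" for z :: "real ^ 'n"
  unfolding power2_norm_eq_inner by (simp add: inner_vec_def power2_eq_square)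

lemma std_normal_density_prod:
  "(\<Prod>i\<in>UNIV. std_normal_density (z $ i)) = (1 / sqrt (2 * pi)) ^ CARD('n) * exp (- (norm z)\<^sup>2 / 2)"
  for z :: "real ^ 'n"
proof -
  have "(\<Prod>i\<in>UNIV. std_normal_density (z $ i))
      = (1 / sqrt (2 * pi)) ^ CARD('n) * exp (\<Sum>i\<in>UNIV. - (z $ i)\<^sup>2 / 2)"
    by (simp add: std_normal_density_def prod_dividef exp_sum power_divide)
  also have "(\<Sum>i\<in>UNIV. - (z $ i)\<^sup>2 / 2) = - (norm z)\<^sup>2 / 2"
    by (simp add: norm_vec_power2 sum_divide_distrib sum_negf)
  finally show ?thesis .
qed

lemma char_vec_std_normal_vec:
  "char_vec std_normal_vec t = complex_of_real (exp (- (norm t)\<^sup>2 / 2))" for t :: "real ^ 'n"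
proof -
  have i1: "integrable lborel (\<lambda>x. complex_of_real (std_normal_density x) * iexp (s * x))" for s
    by (rule Bochner_Integration.integrable_bound[where f = std_normal_density])
       (auto simp: norm_mult)
  have "char_vec std_normal_vec t =
     (\<integral>z. (\<Prod>i\<in>UNIV. std_normal_density (z $ i)) *\<^sub>R iexp (t \<bullet> z) \<partial>lborel)"
    unfolding char_vec_def std_normal_vec_def
    by (subst integral_density) (auto simp: prod_nonneg)
  also have "\<dots> = (\<integral>z. (\<Prod>i\<in>UNIV. complex_of_real (std_normal_density (z $ i)) * iexp (t $ i * z $ i)) \<partial>lborel)"
    unfolding iexp_inner_vec by (simp add: scaleR_conv_of_real prod.distrib)
  also have "\<dots> = (\<Prod>i\<in>UNIV. \<integral>x. complex_of_real (std_normal_density x) * iexp (t $ i * x) \<partial>lborel)"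
    by (rule integral_lborel_vec_prod) (rule i1)
  also have "\<dots> = (\<Prod>i\<in>UNIV. char std_normal_distribution (t $ i))"
    unfolding char_def by (intro prod.cong refl, subst integral_density) (auto simp: scaleR_conv_of_real)
  also have "\<dots> = complex_of_real (exp (\<Sum>i\<in>UNIV. - (t $ i)\<^sup>2 / 2))"
    by (simp add: char_std_normal_distribution exp_sum of_real_exp[symmetric] del: of_real_exp)
  also have "(\<Sum>i\<in>UNIV. - (t $ i)\<^sup>2 / 2) = - (norm t)\<^sup>2 / 2"
    by (simp add: norm_vec_power2 sum_divide_distrib sum_negf)
  finally show ?thesis .
qed

lemma (in prob_space) integrable_iexp [simp]:
  assumes "g \<in> borel_measurable M" shows "integrable M (\<lambda>x. iexp (g x))"
  by (rule integrable_const_bound[where B = 1]) (use assms in auto)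

text \<open>The Gaussian kernel is its own Fourier transform, so its integral against \<open>\<mu>\<close> depends only on
  the characteristic function of \<open>\<mu>\<close>.\<close>

lemma gaussian_kernel_integral_char_vec:
  fixes \<mu> :: "(real ^ 'n) measure"
  assumes "prob_space \<mu>" and [measurable_cong]: "sets \<mu> = sets borel"
  shows "complex_of_real (\<integral>x. exp (- (norm (a *\<^sub>R (w - x)))\<^sup>2 / 2) \<partial>\<mu>)
    = (CLINT z|std_normal_vec. iexp (a * (w \<bullet> z)) * char_vec \<mu> (- (a *\<^sub>R z)))"
proof -
  interpret \<mu>: prob_space \<mu> by fact
  interpret G: prob_space "std_normal_vec :: (real ^ 'n) measure" by (rule prob_space_std_normal_vec)
  interpret P: pair_sigma_finite \<mu> "std_normal_vec :: (real ^ 'n) measure" ..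
  interpret PP: prob_space "\<mu> \<Otimes>\<^sub>M (std_normal_vec :: (real ^ 'n) measure)"
    by (rule prob_space_pair) (rule assms(1), rule prob_space_std_normal_vec)
  have e: "iexp ((a *\<^sub>R (w - x)) \<bullet> z) = iexp (a * (w \<bullet> z)) * iexp ((- (a *\<^sub>R z)) \<bullet> x)" for x z
    by (simp add: exp_add[symmetric] inner_diff_left inner_commute algebra_simps)
  have int: "integrable (\<mu> \<Otimes>\<^sub>M std_normal_vec) (\<lambda>(x, z). iexp ((a *\<^sub>R (w - x)) \<bullet> z))"
    unfolding case_prod_beta by (rule PP.integrable_iexp) measurable
  have "complex_of_real (\<integral>x. exp (- (norm (a *\<^sub>R (w - x)))\<^sup>2 / 2) \<partial>\<mu>)
      = (CLINT x|\<mu>. char_vec std_normal_vec (a *\<^sub>R (w - x)))"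
    unfolding char_vec_std_normal_vec by (rule integral_complex_of_real[symmetric])
  also have "\<dots> = (CLINT z|std_normal_vec. CLINT x|\<mu>. iexp ((a *\<^sub>R (w - x)) \<bullet> z))"
    unfolding char_vec_def by (rule P.Fubini_integral[OF int, symmetric])
  also have "\<dots> = (CLINT z|std_normal_vec. iexp (a * (w \<bullet> z)) * char_vec \<mu> (- (a *\<^sub>R z)))"
    unfolding e char_vec_def by simp
  finally show ?thesis .
qed

lemma norm_char_vec_le: "prob_space \<mu> \<Longrightarrow> norm (char_vec \<mu> t) \<le> 1"
proof -
  assume "prob_space \<mu>"
  then interpret prob_space \<mu> .
  have "norm (char_vec \<mu> t) \<le> (\<integral>x. norm (iexp (t \<bullet> x)) \<partial>\<mu>)"
    unfolding char_vec_def by (rule integral_norm_bound)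
  then show ?thesis by (simp add: prob_space)
qed

lemma borel_measurable_char_vec [measurable]:
  assumes "prob_space \<mu>" and [measurable_cong]: "sets \<mu> = sets borel"
  shows "char_vec \<mu> \<in> borel_measurable borel"
proof -
  interpret prob_space \<mu> by fact
  show ?thesis unfolding char_vec_def[abs_def] by measurable
qed

text \<open>The preceding identity moves the dependence on \<open>n\<close> into the integrand over
  the fixed law \<open>std_normal_vec\<close>. Characteristic functions have modulus at most 1, so
  pointwise convergence passes to the integral.\<close>

lemma gaussian_kernel_integral_converges:
  fixes \<mu> :: "nat \<Rightarrow> (real ^ 'n) measure"
  assumes \<mu>: "\<And>n. prob_space (\<mu> n)" "\<And>n. sets (\<mu> n) = sets borel"
    and N: "prob_space N" "sets N = sets borel"
    and char: "\<And>t. (\<lambda>n. char_vec (\<mu> n) t) \<longlonglongrightarrow> char_vec N t"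
  shows "(\<lambda>n. \<integral>x. exp (- (norm (a *\<^sub>R (w - x)))\<^sup>2 / 2) \<partial>\<mu> n)
      \<longlonglongrightarrow> (\<integral>x. exp (- (norm (a *\<^sub>R (w - x)))\<^sup>2 / 2) \<partial>N)"
proof -
  interpret G: prob_space "std_normal_vec :: (real ^ 'n) measure" by (rule prob_space_std_normal_vec)
  note [measurable] = borel_measurable_char_vec[OF \<mu>] borel_measurable_char_vec[OF N]
  have "(\<lambda>n. complex_of_real (\<integral>x. exp (- (norm (a *\<^sub>R (w - x)))\<^sup>2 / 2) \<partial>\<mu> n))
      \<longlonglongrightarrow> complex_of_real (\<integral>x. exp (- (norm (a *\<^sub>R (w - x)))\<^sup>2 / 2) \<partial>N)"
    unfolding gaussian_kernel_integral_char_vec[OF \<mu>] gaussian_kernel_integral_char_vec[OF N]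
    by (rule integral_dominated_convergence[where w = "\<lambda>_. 1"])
       (auto simp: norm_mult intro!: tendsto_mult char norm_char_vec_le \<mu>)
  then show ?thesis by (simp only: tendsto_of_real_iff)
qed

text \<open>The substitution \<open>w = x + z / a\<close> frees \<open>g\<close> of \<open>x\<close>
  and leaves \<open>x\<close> only in a Gaussian kernel, whose integral over \<open>x\<close> is
  controlled by characteristic functions.\<close>

lemma integral_gaussian_shift:
  fixes g :: "real ^ 'n \<Rightarrow> real"
  assumes a: "a > 0" and [measurable]: "g \<in> borel_measurable borel"
  shows "(\<integral>z. g (x + (1 / a) *\<^sub>R z) \<partial>std_normal_vec)
    = (a / sqrt (2 * pi)) ^ CARD('n) * (\<integral>w. g w * exp (- (norm (a *\<^sub>R (w - x)))\<^sup>2 / 2) \<partial>lborel)"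
proof -
  let ?p = "\<lambda>z :: real ^ 'n. \<Prod>i\<in>UNIV. std_normal_density (z $ i)"
  let ?h = "\<lambda>w. g w * exp (- (norm (a *\<^sub>R (w - x)))\<^sup>2 / 2)"
  have "(\<integral>z. g (x + (1 / a) *\<^sub>R z) \<partial>std_normal_vec) = (\<integral>z. ?p z * g (x + (1 / a) *\<^sub>R z) \<partial>lborel)"
    unfolding std_normal_vec_def by (subst integral_density) (auto simp: prod_nonneg)
  also have "\<dots> = (1 / sqrt (2 * pi)) ^ CARD('n) * (\<integral>z. ?h (x + (1 / a) *\<^sub>R z) \<partial>lborel)"
    unfolding std_normal_density_prod using a
    by (subst integral_mult_right_zero[symmetric]) (auto intro!: Bochner_Integration.integral_cong simp: mult_ac)
  also have "(\<integral>w. ?h w \<partial>lborel) = (1 / a) ^ CARD('n) * (\<integral>z. ?h (x + (1 / a) *\<^sub>R z) \<partial>lborel)"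
    using a by (subst lborel_affine[of "1 / a" x])
       (auto simp: integral_density integral_distr power_divide)
  then have "(\<integral>z. ?h (x + (1 / a) *\<^sub>R z) \<partial>lborel) = a ^ CARD('n) * (\<integral>w. ?h w \<partial>lborel)"
    using a by (simp add: field_simps)
  finally show ?thesis by (simp add: power_divide)
qed

lemma (in prob_space) norm_tail_small:
  fixes X :: "'a \<Rightarrow> 'b::{second_countable_topology, real_normed_vector}"
  assumes [measurable]: "X \<in> borel_measurable M" and "0 < e"
  shows "\<exists>r::nat. prob {x \<in> space M. real r < norm (X x)} < e"
proof -
  define A where "A r = {x \<in> space M. real r < norm (X x)}" for r :: nat
  have "(\<lambda>r. prob (A r)) \<longlonglongrightarrow> prob (\<Inter>r. A r)"
    by (rule finite_Lim_measure_decseq) (auto simp: A_def decseq_def image_subset_iff)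
  moreover have "(\<Inter>r. A r) = {}"
  proof -
    have "x \<notin> A (nat \<lceil>norm (X x)\<rceil>)" for x
      using real_nat_ceiling_ge[of "norm (X x)"] by (simp add: A_def not_less)
    then show ?thesis by blast
  qed
  ultimately have "(\<lambda>r. prob (A r)) \<longlonglongrightarrow> 0" by simp
  from order_tendstoD(2)[OF this \<open>0 < e\<close>] show ?thesis
    unfolding A_def by (auto simp: eventually_sequentially)
qed

text \<open>After Fubini the smoothed integral is a constant times the Lebesgue integral of
  \<open>g w\<close> against the kernel integral at \<open>w\<close>. The latter converges for each
  \<open>w\<close> and lies between 0 and 1, so \<open>\<bar>g\<bar>\<close> dominates.\<close>

lemma integral_gaussian_shift_converges:
  fixes \<mu> :: "nat \<Rightarrow> (real ^ 'n) measure" and g :: "real ^ 'n \<Rightarrow> real"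
  assumes \<mu>: "\<And>n. prob_space (\<mu> n)" "\<And>n. sets (\<mu> n) = sets borel"
    and N: "prob_space N" "sets N = sets borel"
    and char: "\<And>t. (\<lambda>n. char_vec (\<mu> n) t) \<longlonglongrightarrow> char_vec N t"
    and g: "integrable lborel g" and a: "a > 0"
  shows "(\<lambda>n. \<integral>x. (\<integral>z. g (x + (1 / a) *\<^sub>R z) \<partial>std_normal_vec) \<partial>\<mu> n)
      \<longlonglongrightarrow> (\<integral>x. (\<integral>z. g (x + (1 / a) *\<^sub>R z) \<partial>std_normal_vec) \<partial>N)"
proof -
  let ?k = "\<lambda>w x. exp (- (norm (a *\<^sub>R (w - x)))\<^sup>2 / 2)"
  have gm[measurable]: "g \<in> borel_measurable borel" using g by simp
  have swap: "(\<integral>x. (\<integral>z. g (x + (1 / a) *\<^sub>R z) \<partial>std_normal_vec) \<partial>\<nu>)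
    = (a / sqrt (2 * pi)) ^ CARD('n) * (\<integral>w. g w * (\<integral>x. ?k w x \<partial>\<nu>) \<partial>lborel)"
    if \<nu>: "prob_space \<nu>" and [measurable_cong]: "sets \<nu> = sets borel" for \<nu> :: "(real ^ 'n) measure"
  proof -
    interpret \<nu>: prob_space \<nu> by fact
    interpret P: pair_sigma_finite \<nu> "lborel :: (real ^ 'n) measure" ..
    have int: "integrable (\<nu> \<Otimes>\<^sub>M lborel) (\<lambda>(x, w). g w * ?k w x)"
    proof (rule Bochner_Integration.integrable_bound)
      show "integrable (\<nu> \<Otimes>\<^sub>M lborel) (\<lambda>(x, w). g w)"
        by (rule P.Fubini_integrable) (auto simp: g)
      show "(\<lambda>(x, w). g w * ?k w x) \<in> borel_measurable (\<nu> \<Otimes>\<^sub>M lborel)" by measurable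
      show "AE p in \<nu> \<Otimes>\<^sub>M lborel. norm (case p of (x, w) \<Rightarrow> g w * ?k w x) \<le> norm (case p of (x, w) \<Rightarrow> g w)"
        by (rule AE_I2) (auto simp: abs_mult split_beta intro!: mult_left_le)
    qed
    have "(\<integral>x. (\<integral>w. g w * ?k w x \<partial>lborel) \<partial>\<nu>) = (\<integral>w. (\<integral>x. g w * ?k w x \<partial>\<nu>) \<partial>lborel)"
      by (rule P.Fubini_integral[OF int, symmetric])
    then show ?thesis unfolding integral_gaussian_shift[OF a gm] by simp
  qed
  have "(\<lambda>n. \<integral>w. g w * (\<integral>x. ?k w x \<partial>\<mu> n) \<partial>lborel) \<longlonglongrightarrow> (\<integral>w. g w * (\<integral>x. ?k w x \<partial>N) \<partial>lborel)"
  proof (rule integral_dominated_convergence[where w = "\<lambda>w. \<bar>g w\<bar>"])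
    show "(\<lambda>w. g w * (\<integral>x. ?k w x \<partial>\<mu> n)) \<in> borel_measurable lborel" for n
    proof -
      interpret prob_space "\<mu> n" by fact
      note [measurable_cong] = \<mu>(2)[of n]
      show ?thesis by measurable
    qed
    interpret N: prob_space N by fact
    note [measurable_cong] = N(2)
    show "(\<lambda>w. g w * (\<integral>x. ?k w x \<partial>N)) \<in> borel_measurable lborel" by measurable
    show "integrable lborel (\<lambda>w. \<bar>g w\<bar>)" using g by simp
    show "AE w in lborel. (\<lambda>n. g w * (\<integral>x. ?k w x \<partial>\<mu> n)) \<longlonglongrightarrow> g w * (\<integral>x. ?k w x \<partial>N)"
      by (intro AE_I2 tendsto_mult tendsto_const gaussian_kernel_integral_converges assms)
    show "AE w in lborel. norm (g w * (\<integral>x. ?k w x \<partial>\<mu> n)) \<le> \<bar>g w\<bar>" for n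
    proof (rule AE_I2)
      fix w
      interpret prob_space "\<mu> n" by fact
      note [measurable_cong] = \<mu>(2)[of n]
      have i: "integrable (\<mu> n) (?k w)" by (rule integrable_const_bound[where B = 1]) auto
      have "(\<integral>x. ?k w x \<partial>\<mu> n) \<le> (\<integral>x. 1 \<partial>\<mu> n)" by (intro integral_mono i) auto
      moreover have "0 \<le> (\<integral>x. ?k w x \<partial>\<mu> n)" by simp
      ultimately show "norm (g w * (\<integral>x. ?k w x \<partial>\<mu> n)) \<le> \<bar>g w\<bar>"
        by (auto simp: abs_mult prob_space intro!: mult_left_le)
    qed
  qed
  then show ?thesis unfolding swap[OF \<mu>] swap[OF N] by (intro tendsto_mult tendsto_const)
qed

lemma uniformly_close_of_compact_support:
  fixes g :: "real ^ 'n \<Rightarrow> real"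
  assumes cont: "continuous_on UNIV g" and supp: "\<And>x. R < norm x \<Longrightarrow> g x = 0" and e: "0 < e"
  shows "\<exists>d>0. \<forall>x u. norm u < d \<longrightarrow> \<bar>g (x + u) - g x\<bar> < e"
proof -
  have "uniformly_continuous_on (cball 0 (R + 2)) g"
    by (rule compact_uniformly_continuous) (use cont continuous_on_subset in auto)
  then obtain d where d: "0 < d" "\<And>x y. x \<in> cball 0 (R + 2) \<Longrightarrow> y \<in> cball 0 (R + 2) \<Longrightarrow> dist y x < d \<Longrightarrow> dist (g y) (g x) < e"
    unfolding uniformly_continuous_on_def using e by metis
  \<comment> \<open>Since \<open>u\<close> is shorter than 1, either \<open>x\<close> and
    \<open>x + u\<close> both lie in the ball of radius \<open>R + 2\<close>, or both lie outside
    radius \<open>R\<close>, where \<open>g\<close> is zero.\<close>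
  have "\<bar>g (x + u) - g x\<bar> < e" if u: "norm u < min d 1" for x u
  proof (cases "norm x \<le> R + 1")
    case True
    then have "x + u \<in> cball 0 (R + 2)" unfolding mem_cball_0 using norm_triangle_ineq[of x u] u by linarith
    moreover have "x \<in> cball 0 (R + 2)" using True by simp
    ultimately have "dist (g (x + u)) (g x) < e" using u by (intro d(2)) (simp_all add: dist_norm)
    then show ?thesis by (simp add: dist_real_def)
  next
    case False
    then have "R < norm (x + u)" using norm_diff_ineq[of x u] u by linarith
    then show ?thesis using supp[of x] supp[of "x + u"] False e by simp
  qed
  then show ?thesis using d(1) by (intro exI[of _ "min d 1"]) auto
qed

text \<open>Short shifts change \<open>g\<close> little by uniform continuity; long ones have small
  Gaussian probability and cost at most \<open>2 B\<close>.\<close>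

lemma gaussian_shift_uniformly_close:
  fixes g :: "real ^ 'n \<Rightarrow> real"
  assumes cont: "continuous_on UNIV g" and supp: "\<And>x. R < norm x \<Longrightarrow> g x = 0"
    and bd: "\<And>x. \<bar>g x\<bar> \<le> B" and e: "0 < e"
  shows "\<exists>a>0. \<forall>x. \<bar>(\<integral>z. g (x + (1 / a) *\<^sub>R z) \<partial>std_normal_vec) - g x\<bar> \<le> e"
proof -
  interpret G: prob_space "std_normal_vec :: (real ^ 'n) measure" by (rule prob_space_std_normal_vec)
  have B0: "0 \<le> B" using bd[of 0] by linarith
  obtain d where d: "0 < d" "\<And>x u. norm u < d \<Longrightarrow> \<bar>g (x + u) - g x\<bar> < e / 2"
    using uniformly_close_of_compact_support[OF cont supp half_gt_zero[OF e]] by metis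
  \<comment> \<open>Chosen so that \<open>2 * B * e'\<close> is at most \<open>e / 2\<close>; the
    summand 1 keeps the denominator positive when \<open>B = 0\<close>.\<close>
  define e' where "e' = e / (4 * B + 1)"
  have e'0: "0 < e'" using e B0 by (simp add: e'_def)
  obtain r :: nat where r: "G.prob {x \<in> space std_normal_vec. real r < norm (x :: real ^ 'n)} < e'"
    using G.norm_tail_small[of "\<lambda>x. x" e'] e'0 by auto
  let ?A = "{x :: real ^ 'n. real r < norm x}"
  \<comment> \<open>With this \<open>a\<close>, every \<open>z\<close> of norm at most
    \<open>r\<close> is scaled to norm below \<open>d\<close>.\<close>
  define a where "a = (real r + 1) / d"
  have a0: "0 < a" using d(1) by (simp add: a_def)
  have [measurable]: "g \<in> borel_measurable borel" using cont by (rule borel_measurable_continuous_onI)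
  have ig: "integrable std_normal_vec (\<lambda>z. g (x + (1 / a) *\<^sub>R z))" for x
    by (rule G.integrable_const_bound[where B = B]) (use bd in auto)
  have ia: "integrable std_normal_vec (\<lambda>z. e / 2 + 2 * B * indicator ?A (z :: real ^ 'n))"
    by (rule G.integrable_const_bound[where B = "e / 2 + 2 * B"]) (use e B0 in \<open>auto simp: indicator_def\<close>)
  have "\<bar>(\<integral>z. g (x + (1 / a) *\<^sub>R z) \<partial>std_normal_vec) - g x\<bar> \<le> e" for x
  proof -
    have "\<bar>(\<integral>z. g (x + (1 / a) *\<^sub>R z) \<partial>std_normal_vec) - g x\<bar>
        = \<bar>\<integral>z. g (x + (1 / a) *\<^sub>R z) - g x \<partial>std_normal_vec\<bar>"
      using ig[of x] by (simp add: G.prob_space[simplified])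
    also have "\<dots> \<le> (\<integral>z. \<bar>g (x + (1 / a) *\<^sub>R z) - g x\<bar> \<partial>std_normal_vec)"
      using integral_norm_bound[of std_normal_vec "\<lambda>z. g (x + (1 / a) *\<^sub>R z) - g x"] by simp
    also have "\<dots> \<le> (\<integral>z. e / 2 + 2 * B * indicator ?A (z :: real ^ 'n) \<partial>std_normal_vec)"
    proof (rule integral_mono)
      fix z :: "real ^ 'n"
      show "\<bar>g (x + (1 / a) *\<^sub>R z) - g x\<bar> \<le> e / 2 + 2 * B * indicator ?A z"
      proof (cases "real r < norm z")
        case True
        then show ?thesis using bd[of x] bd[of "x + (1 / a) *\<^sub>R z"] e by simp
      next
        case False
        have "norm z < a * d" using False d(1) by (simp add: a_def)
        then have "norm ((1 / a) *\<^sub>R z) < d" using a0 by (simp add: pos_divide_less_eq mult.commute)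
        then show ?thesis using d(2)[of "(1 / a) *\<^sub>R z" x] False by simp
      qed
    qed (use ig ia in auto)
    also have "\<dots> = e / 2 + 2 * B * G.prob ?A"
    proof -
      have "integrable std_normal_vec (indicat_real ?A)"
        by (rule G.integrable_const_bound[where B = 1]) auto
      then show ?thesis by (simp add: G.prob_space[simplified])
    qed
    also have "\<dots> \<le> e / 2 + 2 * B * e'"
      using r B0 by (intro add_left_mono mult_left_mono) auto
    also have "\<dots> \<le> e" using B0 e by (simp add: e'_def field_simps)
    finally show ?thesis .
  qed
  then show ?thesis using a0 by blast
qed

text \<open>Gaussian smoothing moves the integral of \<open>g\<close> by at most
  \<open>e / 4\<close> under every probability measure at once, and smoothed integrals converge.
  Compact support supplies both the uniform continuity and the Lebesgue integrability that this
  takes.\<close>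

lemma compact_support_integral_converges:
  fixes \<mu> :: "nat \<Rightarrow> (real ^ 'n) measure" and g :: "real ^ 'n \<Rightarrow> real"
  assumes \<mu>: "\<And>n. prob_space (\<mu> n)" "\<And>n. sets (\<mu> n) = sets borel"
    and N: "prob_space N" "sets N = sets borel"
    and char: "\<And>t. (\<lambda>n. char_vec (\<mu> n) t) \<longlonglongrightarrow> char_vec N t"
    and cont: "continuous_on UNIV g" and supp: "\<And>x. R < norm x \<Longrightarrow> g x = 0"
    and bd: "\<And>x. \<bar>g x\<bar> \<le> B"
  shows "(\<lambda>n. \<integral>x. g x \<partial>\<mu> n) \<longlonglongrightarrow> (\<integral>x. g x \<partial>N)"
proof (rule LIMSEQ_I)
  fix e :: real assume "0 < e"
  then have e4: "0 < e / 4" by simp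
  interpret G: prob_space "std_normal_vec :: (real ^ 'n) measure" by (rule prob_space_std_normal_vec)
  obtain a where a: "a > 0" and
    close: "\<And>x. \<bar>(\<integral>z. g (x + (1 / a) *\<^sub>R z) \<partial>std_normal_vec) - g x\<bar> \<le> e / 4"
    using gaussian_shift_uniformly_close[OF cont supp bd e4] by blast
  define s where "s x = (\<integral>z. g (x + (1 / a) *\<^sub>R z) \<partial>std_normal_vec)" for x
  have gm[measurable]: "g \<in> borel_measurable borel" using cont by (rule borel_measurable_continuous_onI)
  have [measurable]: "s \<in> borel_measurable borel" unfolding s_def[abs_def] by measurable
  have sbd: "\<bar>s x\<bar> \<le> B + e / 4" for x using close[of x] bd[of x] unfolding s_def by linarith
  have "integrable lborel (\<lambda>x. indicator (cball 0 R) x *\<^sub>R g x)"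
    by (rule borel_integrable_compact) (use cont continuous_on_subset in auto)
  also have "(\<lambda>x. indicator (cball 0 R) x *\<^sub>R g x) = g"
    using supp by (auto simp: indicator_def fun_eq_iff)
  finally have ig: "integrable lborel g" .
  have diff: "\<bar>(\<integral>x. s x \<partial>\<nu>) - (\<integral>x. g x \<partial>\<nu>)\<bar> \<le> e / 4"
    if "prob_space \<nu>" and [measurable_cong]: "sets \<nu> = sets borel" for \<nu> :: "(real ^ 'n) measure"
  proof -
    interpret \<nu>: prob_space \<nu> by fact
    have i: "integrable \<nu> s" "integrable \<nu> g"
      by (auto intro!: \<nu>.integrable_const_bound[where B = "B + e / 4"] AE_I2 sbd order_trans[OF bd] simp: \<open>0 < e\<close> less_imp_le)
    have "\<bar>(\<integral>x. s x \<partial>\<nu>) - (\<integral>x. g x \<partial>\<nu>)\<bar> = \<bar>\<integral>x. s x - g x \<partial>\<nu>\<bar>" using i by simp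
    also have "\<dots> \<le> (\<integral>x. \<bar>s x - g x\<bar> \<partial>\<nu>)"
      using integral_norm_bound[of \<nu> "\<lambda>x. s x - g x"] by simp
    also have "\<dots> \<le> (\<integral>x. e / 4 \<partial>\<nu>)"
      by (intro integral_mono integrable_abs Bochner_Integration.integrable_diff i)
         (use close in \<open>auto simp: s_def\<close>)
    finally show ?thesis by (simp add: \<nu>.prob_space)
  qed
  have "(\<lambda>n. \<integral>x. s x \<partial>\<mu> n) \<longlonglongrightarrow> (\<integral>x. s x \<partial>N)"
    unfolding s_def by (rule integral_gaussian_shift_converges[OF \<mu> N char ig a])
  from LIMSEQ_D[OF this e4] obtain n0 where
    n0: "\<And>n. n \<ge> n0 \<Longrightarrow> \<bar>(\<integral>x. s x \<partial>\<mu> n) - (\<integral>x. s x \<partial>N)\<bar> < e / 4" by auto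
  have "norm ((\<integral>x. g x \<partial>\<mu> n) - (\<integral>x. g x \<partial>N)) < e" if "n \<ge> n0" for n
    using n0[OF that] diff[OF \<mu>, of n] diff[OF N] \<open>0 < e\<close> unfolding real_norm_def by linarith
  then show "\<exists>n0. \<forall>n\<ge>n0. norm ((\<integral>x. g x \<partial>\<mu> n) - (\<integral>x. g x \<partial>N)) < e" by blast
qed

text \<open>No separate tightness argument is needed: since the limit is a probability measure, testing
  the convergence against the cutoff \<open>c\<close> bounds the mass of \<open>\<mu> n\<close> outside a large ball.\<close>

theorem weakly_converges_if_char_vec_converges:
  fixes \<mu> :: "nat \<Rightarrow> (real ^ 'n) measure"
  assumes \<mu>: "\<And>n. prob_space (\<mu> n)" "\<And>n. sets (\<mu> n) = sets borel"
    and N: "prob_space N" "sets N = sets borel"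
    and char: "\<And>t. (\<lambda>n. char_vec (\<mu> n) t) \<longlonglongrightarrow> char_vec N t"
  shows "weakly_converges \<mu> N"
  unfolding weakly_converges_def
proof (intro allI impI LIMSEQ_I)
  fix g :: "real ^ 'n \<Rightarrow> real" and e :: real
  assume "continuous_on UNIV g \<and> bounded (range g)" and e: "0 < e"
  then have cont: "continuous_on UNIV g" and "bounded (range g)" by auto
  then obtain B where B0: "0 < B" and bd: "\<And>x. \<bar>g x\<bar> \<le> B"
    unfolding bounded_pos by auto
  interpret N: prob_space N by fact
  have spN: "space N = UNIV" using sets_eq_imp_space_eq[OF N(2)] by simp
  \<comment> \<open>Cutting off costs less than \<open>B * e' = e / 6\<close> under
    \<open>\<mu> n\<close> and under \<open>N\<close>; together with \<open>e / 2\<close> for the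
    truncated integrals this stays below \<open>e\<close>.\<close>
  define e' where "e' = e / (6 * B)"
  have e'0: "0 < e'" using e B0 by (simp add: e'_def)
  note [measurable_cong] = N(2) \<mu>(2)
  obtain r :: nat where r: "N.prob {x \<in> space N. real r < norm x} < e'"
    using N.norm_tail_small[of "\<lambda>x. x" e'] e'0 by auto
  define c where "c x = max 0 (min 1 (real r + 1 - norm x))" for x :: "real ^ 'n"
  have c01: "0 \<le> c x" "c x \<le> 1" for x by (auto simp: c_def)
  have ccont: "continuous_on UNIV c" unfolding c_def by (intro continuous_intros)
  have [measurable]: "g \<in> borel_measurable borel" "c \<in> borel_measurable borel"
    using cont ccont by (auto intro: borel_measurable_continuous_onI)
  have csupp: "real r + 1 < norm x \<Longrightarrow> c x = 0" for x by (simp add: c_def)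
  have "(\<lambda>n. \<integral>x. c x \<partial>\<mu> n) \<longlonglongrightarrow> (\<integral>x. c x \<partial>N)"
    by (rule compact_support_integral_converges[OF assms ccont csupp, where B = 1]) (use c01 in auto)
  moreover have "1 - e' < (\<integral>x. c x \<partial>N)"
  proof -
    have "(\<integral>x. 1 - indicator {x. real r < norm x} x \<partial>N) \<le> (\<integral>x. c x \<partial>N)"
      by (rule integral_mono)
         (auto intro!: N.integrable_const_bound[where B = 1] simp: c01, auto simp: c_def indicator_def)
    moreover have "(\<integral>x. 1 - indicator {x. real r < norm x} x \<partial>N) = 1 - N.prob {x. real r < norm x}"
      by (subst Bochner_Integration.integral_diff)
         (auto intro!: N.integrable_const_bound[where B = 1] simp: N.prob_space[unfolded spN] spN)
    ultimately show ?thesis using r spN by simp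
  qed
  ultimately have "eventually (\<lambda>n. 1 - e' < (\<integral>x. c x \<partial>\<mu> n)) sequentially"
    by (rule order_tendstoD(1))
  moreover have "(\<lambda>n. \<integral>x. g x * c x \<partial>\<mu> n) \<longlonglongrightarrow> (\<integral>x. g x * c x \<partial>N)"
  proof (rule compact_support_integral_converges[OF assms, where R = "real r + 1" and B = B])
    show "continuous_on UNIV (\<lambda>x. g x * c x)" by (intro continuous_intros cont ccont)
    show "\<bar>g x * c x\<bar> \<le> B" for x
      using mult_mono[OF bd[of x] c01(2)[of x]] c01[of x] B0 by (simp add: abs_mult)
  qed (simp add: csupp)
  then have "eventually (\<lambda>n. dist (\<integral>x. g x * c x \<partial>\<mu> n) (\<integral>x. g x * c x \<partial>N) < e / 2) sequentially"
    using e by (intro tendstoD) auto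
  ultimately have "eventually (\<lambda>n. norm ((\<integral>x. g x \<partial>\<mu> n) - (\<integral>x. g x \<partial>N)) < e) sequentially"
  proof eventually_elim
    case (elim n)
    \<comment> \<open>The error of replacing \<open>g\<close> by \<open>g * c\<close> is controlled
      by the integral of \<open>c\<close> alone, so the convergence of that single integral acts as
      tightness.\<close>
    have cut: "\<bar>(\<integral>x. g x \<partial>\<nu>) - (\<integral>x. g x * c x \<partial>\<nu>)\<bar> \<le> B * (1 - (\<integral>x. c x \<partial>\<nu>))"
      if "prob_space \<nu>" and [measurable_cong]: "sets \<nu> = sets borel" for \<nu> :: "(real ^ 'n) measure"
    proof -
      interpret \<nu>: prob_space \<nu> by fact
      have ic: "integrable \<nu> c" by (rule \<nu>.integrable_const_bound[where B = 1]) (auto simp: c01)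
      have ig: "integrable \<nu> g" by (rule \<nu>.integrable_const_bound[where B = B]) (use bd in auto)
      have igc: "integrable \<nu> (\<lambda>x. g x * c x)"
        by (rule Bochner_Integration.integrable_bound[OF ig]) (auto simp: abs_mult c01 intro!: mult_left_le)
      have "\<bar>(\<integral>x. g x \<partial>\<nu>) - (\<integral>x. g x * c x \<partial>\<nu>)\<bar> = \<bar>\<integral>x. g x - g x * c x \<partial>\<nu>\<bar>" using ig igc by simp
      also have "\<dots> \<le> (\<integral>x. \<bar>g x - g x * c x\<bar> \<partial>\<nu>)"
        using integral_norm_bound[of \<nu> "\<lambda>x. g x - g x * c x"] by simp
      also have "\<dots> \<le> (\<integral>x. B * (1 - c x) \<partial>\<nu>)"
      proof (rule integral_mono)
        fix x
        have "\<bar>g x - g x * c x\<bar> = \<bar>g x\<bar> * (1 - c x)"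
          using c01[of x] abs_mult[of "g x" "1 - c x"] by (simp add: right_diff_distrib)
        also have "\<dots> \<le> B * (1 - c x)" using bd[of x] c01[of x] by (intro mult_right_mono) auto
        finally show "\<bar>g x - g x * c x\<bar> \<le> B * (1 - c x)" .
      qed (use ic ig igc in auto)
      also have "\<dots> = B * (1 - (\<integral>x. c x \<partial>\<nu>))" using ic by (simp add: \<nu>.prob_space)
      finally show ?thesis .
    qed
    have "B * (1 - (\<integral>x. c x \<partial>\<mu> n)) < B * e'" using elim(1) B0 by (intro mult_strict_left_mono) auto
    moreover have "B * (1 - (\<integral>x. c x \<partial>N)) < B * e'"
      using \<open>1 - e' < (\<integral>x. c x \<partial>N)\<close> B0 by (intro mult_strict_left_mono) auto
    moreover have "B * e' = e / 6" using B0 by (simp add: e'_def)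
    ultimately show ?case
      using cut[OF \<mu>, of n] cut[OF N] elim(2) e unfolding real_norm_def dist_real_def by linarith
  qed
  then show "\<exists>n0. \<forall>n\<ge>n0. norm ((\<integral>x. g x \<partial>\<mu> n) - (\<integral>x. g x \<partial>N)) < e"
    by (simp add: eventually_sequentially)
qed

subsection \<open>Second moments and the multivariate normal distribution\<close>

lemma
  fixes Z :: "'a \<Rightarrow> real ^ 'n"
  assumes [measurable]: "Z \<in> borel_measurable M" and Z2: "integrable M (\<lambda>\<omega>. (norm (Z \<omega>))\<^sup>2)"
  shows integrable_inner_squared: "integrable M (\<lambda>\<omega>. (t \<bullet> Z \<omega>)\<^sup>2)"
    and second_moment_quadratic_form: "t \<bullet> (second_moment_matrix M Z *v t) = (\<integral>\<omega>. (t \<bullet> Z \<omega>)\<^sup>2 \<partial>M)"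
    and transpose_second_moment_matrix: "transpose (second_moment_matrix M Z) = second_moment_matrix M Z"
proof -
  have nth[measurable]: "(\<lambda>\<omega>. Z \<omega> $ i) \<in> borel_measurable M" for i
    by (rule borel_measurable_continuous_on[OF _ assms(1), of "\<lambda>z. z $ i"]) (intro continuous_intros)
  have ij: "integrable M (\<lambda>\<omega>. Z \<omega> $ i * Z \<omega> $ j)" for i j
  proof (rule Bochner_Integration.integrable_bound[OF Z2])
    show "AE \<omega> in M. norm (Z \<omega> $ i * Z \<omega> $ j) \<le> norm ((norm (Z \<omega>))\<^sup>2)"
    proof (rule AE_I2)
      fix \<omega>
      show "norm (Z \<omega> $ i * Z \<omega> $ j) \<le> norm ((norm (Z \<omega>))\<^sup>2)"
        using component_le_norm_cart[of "Z \<omega>" i] component_le_norm_cart[of "Z \<omega>" j]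
        by (simp add: abs_mult power2_eq_square mult_mono)
    qed
  qed measurable
  have sq: "(t \<bullet> z)\<^sup>2 = (\<Sum>i\<in>UNIV. \<Sum>j\<in>UNIV. t $ i * t $ j * (z $ i * z $ j))" for z :: "real ^ 'n"
    by (simp add: inner_vec_def power2_eq_square sum_product mult_ac)
  show "integrable M (\<lambda>\<omega>. (t \<bullet> Z \<omega>)\<^sup>2)"
    unfolding sq by (intro Bochner_Integration.integrable_sum integrable_mult_right ij)
  show "t \<bullet> (second_moment_matrix M Z *v t) = (\<integral>\<omega>. (t \<bullet> Z \<omega>)\<^sup>2 \<partial>M)"
    unfolding sq using ij
    by (simp add: Bochner_Integration.integral_sum inner_vec_def matrix_vector_mult_def
        second_moment_matrix_def sum_distrib_left mult_ac)
  show "transpose (second_moment_matrix M Z) = second_moment_matrix M Z"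
    by (simp add: transpose_def second_moment_matrix_def mult.commute)
qed

text \<open>\<open>multivariate_normal\<close> selects its factor by \<open>SOME\<close>; the
  selected matrix is a genuine factor because one exists for every positive semidefinite matrix,
  including singular ones.\<close>

lemma multivariate_normal_factorization:
  fixes S :: "real ^ 'n ^ 'n"
  assumes "transpose S = S" and "\<And>x. 0 \<le> x \<bullet> (S *v x)"
  obtains A :: "real ^ 'n ^ 'n" where "A ** transpose A = S"
    and "multivariate_normal m S = distr std_normal_vec borel (\<lambda>z. m + A *v z)"
proof
  let ?A = "SOME A :: real ^ 'n ^ 'n. A ** transpose A = S"
  show "?A ** transpose ?A = S"
    by (rule someI_ex) (rule psd_factorization[OF assms])
  show "multivariate_normal m S = distr std_normal_vec borel (\<lambda>z. m + ?A *v z)"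
    by (simp add: multivariate_normal_def Let_def)
qed

lemma borel_measurable_matrix_vector_mult [measurable]:
  "(\<lambda>z. A *v z) \<in> borel_measurable borel" for A :: "real ^ 'n ^ 'm"
  by (intro borel_measurable_continuous_onI linear_continuous_on matrix_vector_mul_bounded_linear)

text \<open>Moving \<open>A\<close> across the inner product evaluates the standard normal
  characteristic function at \<open>A^T t\<close>, whose squared norm is the form of
  \<open>S\<close> at \<open>t\<close>. The result depends on \<open>S\<close> only, whichever
  factor was selected.\<close>

lemma
  fixes S :: "real ^ 'n ^ 'n"
  assumes S: "transpose S = S" "\<And>x. 0 \<le> x \<bullet> (S *v x)"
  shows prob_space_multivariate_normal: "prob_space (multivariate_normal m S)"
    and char_vec_multivariate_normal_0:
      "char_vec (multivariate_normal 0 S) t = complex_of_real (exp (- (t \<bullet> (S *v t)) / 2))"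
proof -
  interpret G: prob_space "std_normal_vec :: (real ^ 'n) measure" by (rule prob_space_std_normal_vec)
  show "prob_space (multivariate_normal m S)"
  proof (rule multivariate_normal_factorization[OF S, of m])
    fix A :: "real ^ 'n ^ 'n"
    assume "multivariate_normal m S = distr std_normal_vec borel (\<lambda>z. m + A *v z)"
    then show ?thesis by (simp add: G.prob_space_distr)
  qed
  obtain A :: "real ^ 'n ^ 'n" where A: "A ** transpose A = S"
    and eq: "multivariate_normal 0 S = distr std_normal_vec borel (\<lambda>z. 0 + A *v z)"
    by (rule multivariate_normal_factorization[OF S])
  have "char_vec (multivariate_normal 0 S) t = char_vec std_normal_vec (transpose A *v t)"
    unfolding char_vec_def eq
    by (subst integral_distr) (auto simp: dot_lmul_matrix[symmetric] transpose_matrix_vector)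
  moreover have "(norm (transpose A *v t))\<^sup>2 = t \<bullet> (S *v t)"
    unfolding power2_norm_eq_inner A[symmetric] matrix_vector_mul_assoc[symmetric]
    by (simp only: transpose_matrix_vector dot_lmul_matrix)
  ultimately show "char_vec (multivariate_normal 0 S) t = complex_of_real (exp (- (t \<bullet> (S *v t)) / 2))"
    by (simp only: char_vec_std_normal_vec)
qed

lemma sets_multivariate_normal [simp]: "sets (multivariate_normal m S) = sets borel"
  by (simp add: multivariate_normal_def Let_def)

subsection \<open>Kernel moments and characteristic function estimates\<close>

text \<open>The substitution \<open>x = h u\<close> turns the quotient into the integral of
  \<open>f (h u) G u\<close>. Boundedness of \<open>f\<close> gives the dominating function and
  continuity at 0 the limit. It serves for \<open>G = K\<close> and for
  \<open>G = K^2\<close>.\<close>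

lemma rescaled_kernel_integral_converges:
  fixes f G :: "real \<Rightarrow> real"
  assumes [measurable]: "f \<in> borel_measurable borel" and bd: "bounded (range f)" and cont: "isCont f 0"
    and G: "integrable lborel G" and h0: "eventually (\<lambda>n. h n > 0) sequentially" and h: "h \<longlonglongrightarrow> 0"
  shows "(\<lambda>n. (\<integral>x. f x * G (x / h n) \<partial>lborel) / h n) \<longlonglongrightarrow> f 0 * (\<integral>u. G u \<partial>lborel)"
proof -
  obtain C where C: "\<And>x. \<bar>f x\<bar> \<le> C" using bd unfolding bounded_iff by auto
  have [measurable]: "G \<in> borel_measurable borel" using G by simp
  have "(\<lambda>n. \<integral>u. f (h n * u) * G u \<partial>lborel) \<longlonglongrightarrow> (\<integral>u. f 0 * G u \<partial>lborel)"
  proof (rule integral_dominated_convergence[where w = "\<lambda>u. C * \<bar>G u\<bar>"])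
    show "integrable lborel (\<lambda>u. C * \<bar>G u\<bar>)" using G by simp
    show "AE u in lborel. (\<lambda>n. f (h n * u) * G u) \<longlonglongrightarrow> f 0 * G u"
    proof (rule AE_I2)
      fix u
      have "(\<lambda>n. h n * u) \<longlonglongrightarrow> 0" using tendsto_mult_left_zero[OF h] by simp
      then have "(\<lambda>n. f (h n * u)) \<longlonglongrightarrow> f 0" using cont isCont_tendsto_compose by blast
      then show "(\<lambda>n. f (h n * u) * G u) \<longlonglongrightarrow> f 0 * G u" by (intro tendsto_mult tendsto_const)
    qed
    show "AE u in lborel. norm (f (h n * u) * G u) \<le> C * \<bar>G u\<bar>" for n
      using C by (intro AE_I2) (simp add: abs_mult mult_right_mono)
  qed measurable
  moreover have "eventually (\<lambda>n. (\<integral>u. f (h n * u) * G u \<partial>lborel) = (\<integral>x. f x * G (x / h n) \<partial>lborel) / h n) sequentially"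
    using h0
  proof eventually_elim
    case (elim n)
    then show ?case by (subst (2) lborel_integral_real_affine[where c = "h n" and t = 0]) auto
  qed
  ultimately show ?thesis by (simp add: filterlim_cong)
qed

text \<open>Both functions are compared with \<open>1 - a^2 v / 2\<close>. The bound keeps the
  factor \<open>a^2 v\<close>, so that for a weight \<open>a\<close> proportional to
  \<open>t \<bullet> Y i\<close> the errors sum using second moments only, while the
  \<open>min\<close> makes them vanish as \<open>a\<close> tends to 0.\<close>

lemma (in prob_space) char_centered_approx_exp:
  fixes Z :: "'a \<Rightarrow> real"
  assumes [measurable]: "random_variable borel Z" and bd: "\<And>\<omega>. \<omega> \<in> space M \<Longrightarrow> 0 \<le> Z \<omega> \<and> Z \<omega> \<le> B"
  shows "cmod ((CLINT \<omega>|M. iexp (a * (Z \<omega> - expectation Z))) - complex_of_real (exp (- (a\<^sup>2 * variance Z / 2))))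
    \<le> 2 * (a\<^sup>2 * variance Z) * min 1 (\<bar>a\<bar> * B)"
proof -
  define X where "X \<omega> = Z \<omega> - expectation Z" for \<omega>
  define v where "v = variance Z"
  have [measurable]: "random_variable borel X" unfolding X_def by measurable
  have iZ: "integrable M Z" by (rule integrable_const_bound[where B = B]) (use bd in auto)
  have B0: "0 \<le> B" using bd not_empty by fastforce
  have EZ: "0 \<le> expectation Z" "expectation Z \<le> B"
    using bd by (auto intro!: integral_nonneg_AE integral_le_const iZ)
  have XB: "\<bar>X \<omega>\<bar> \<le> B" if "\<omega> \<in> space M" for \<omega> using bd[OF that] EZ unfolding X_def by linarith
  have X2B: "(X \<omega>)\<^sup>2 \<le> B\<^sup>2" if "\<omega> \<in> space M" for \<omega>
    using XB[OF that] B0 by (simp add: power2_le_iff_abs_le)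
  have iX: "integrable M X" by (rule integrable_const_bound[where B = B]) (use XB in auto)
  have iX2: "integrable M (\<lambda>\<omega>. (X \<omega>)\<^sup>2)"
    by (rule integrable_const_bound[where B = "B\<^sup>2"]) (use X2B in auto)
  have EX: "expectation X = 0" unfolding X_def using iZ by (simp add: prob_space)
  have EX2: "expectation (\<lambda>\<omega>. (X \<omega>)\<^sup>2) = v" by (simp add: v_def X_def)
  have v0: "0 \<le> v" by (simp add: v_def)
  have vB: "v \<le> B\<^sup>2"
    unfolding EX2[symmetric] by (rule integral_le_const[OF iX2]) (use X2B in auto)
  \<comment> \<open>The 6 comes from the shape of the third-order bound in
    \<open>char_approx3'\<close> and cancels against its prefactor \<open>a^2 / 6\<close>.\<close>
  have pt: "min (6 * x\<^sup>2) (\<bar>a\<bar> * \<bar>x\<bar> ^ 3) \<le> 6 * min 1 (\<bar>a\<bar> * B) * x\<^sup>2" if "\<bar>x\<bar> \<le> B" for x :: real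
  proof -
    have "\<bar>a\<bar> * \<bar>x\<bar> ^ 3 = \<bar>a\<bar> * \<bar>x\<bar> * x\<^sup>2" by (simp add: power3_eq_cube power2_eq_square)
    also have "\<dots> \<le> \<bar>a\<bar> * B * x\<^sup>2" using that by (intro mult_right_mono mult_left_mono) auto
    also have "\<dots> \<le> 6 * (\<bar>a\<bar> * B * x\<^sup>2)" using B0 by simp
    finally show ?thesis by (auto simp: min_def)
  qed
  have "cmod (char (distr M borel X) a - (1 - a\<^sup>2 * v / 2))
      \<le> (a\<^sup>2 / 6) * expectation (\<lambda>\<omega>. min (6 * (X \<omega>)\<^sup>2) (\<bar>a\<bar> * \<bar>X \<omega>\<bar> ^ 3))"
    by (rule char_approx3') (simp_all add: iX iX2 EX EX2)
  also have "\<dots> \<le> (a\<^sup>2 / 6) * expectation (\<lambda>\<omega>. 6 * min 1 (\<bar>a\<bar> * B) * (X \<omega>)\<^sup>2)"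
  proof (intro mult_left_mono integral_mono)
    show "integrable M (\<lambda>\<omega>. min (6 * (X \<omega>)\<^sup>2) (\<bar>a\<bar> * \<bar>X \<omega>\<bar> ^ 3))"
      by (rule Bochner_Integration.integrable_bound[where f = "\<lambda>\<omega>. 6 * (X \<omega>)\<^sup>2"]) (use iX2 in auto)
  qed (use iX2 pt XB in auto)
  also have "\<dots> = a\<^sup>2 * v * min 1 (\<bar>a\<bar> * B)" by (simp add: EX2)
  finally have 1: "cmod (char (distr M borel X) a - (1 - a\<^sup>2 * v / 2)) \<le> a\<^sup>2 * v * min 1 (\<bar>a\<bar> * B)" .
  have 2: "char (distr M borel X) a = (CLINT \<omega>|M. iexp (a * X \<omega>))"
    unfolding char_def by (subst integral_distr) auto
  define b where "b = a\<^sup>2 * v / 2"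
  have b0: "0 \<le> b" using v0 by (simp add: b_def)
  \<comment> \<open>For large \<open>\<bar>a\<bar> * B\<close> the bound \<open>2 * b\<close> is
    enough. Otherwise the error is at most \<open>b^2\<close>, and \<open>v \<le> B^2\<close> lets
    one factor \<open>b\<close> be traded for \<open>2 * (\<bar>a\<bar> * B)\<close>.\<close>
  have "\<bar>(1 - b) - exp (- b)\<bar> \<le> 2 * b * min 1 (\<bar>a\<bar> * B)"
  proof (cases "\<bar>a\<bar> * B \<le> 1")
    case False
    have "exp (- b) \<le> 1" "1 - b \<le> exp (- b)" using exp_ge_add_one_self[of "- b"] b0 by auto
    then have "\<bar>(1 - b) - exp (- b)\<bar> \<le> 2 * b" using b0 by linarith
    then show ?thesis using False by simp
  next
    case True
    have "\<bar>(1 - b) - exp (- b)\<bar> \<le> b\<^sup>2"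
    proof -
      have "1 + b \<le> exp b" by (rule exp_ge_add_one_self)
      then have "exp (- b) \<le> 1 / (1 + b)" using b0 by (simp add: exp_minus inverse_eq_divide frac_le)
      also have "\<dots> \<le> 1 - b + b\<^sup>2" 
      proof -
        have "(1 - b + b\<^sup>2) * (1 + b) = 1 + b ^ 3"
          by (simp add: power2_eq_square power3_eq_cube algebra_simps)
        then have "1 \<le> (1 - b + b\<^sup>2) * (1 + b)" using b0 by simp
        then show ?thesis using b0 by (simp add: pos_divide_le_eq)
      qed
      finally show ?thesis using exp_ge_add_one_self[of "- b"] by simp
    qed
    moreover have "b \<le> 2 * (\<bar>a\<bar> * B)"
    proof -
      have "a\<^sup>2 * v \<le> a\<^sup>2 * B\<^sup>2" using vB by (intro mult_left_mono) auto
      also have "\<dots> = (\<bar>a\<bar> * B) * (\<bar>a\<bar> * B)" by (simp add: power2_eq_square)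
      also have "\<dots> \<le> 1 * (\<bar>a\<bar> * B)" using True B0 by (intro mult_right_mono) auto
      finally have "a\<^sup>2 * v \<le> \<bar>a\<bar> * B" by simp
      moreover have "0 \<le> \<bar>a\<bar> * B" using B0 by simp
      ultimately show ?thesis unfolding b_def by linarith
    qed
    then have "b * b \<le> b * (2 * (\<bar>a\<bar> * B))" using b0 by (intro mult_left_mono) auto
    ultimately show ?thesis using True by (simp add: power2_eq_square mult_ac)
  qed
  then have "cmod (complex_of_real (1 - b) - complex_of_real (exp (- b))) \<le> a\<^sup>2 * v * min 1 (\<bar>a\<bar> * B)"
    unfolding of_real_diff[symmetric] norm_of_real by (simp add: b_def)
  then have "cmod (char (distr M borel X) a - complex_of_real (exp (- b))) \<le> 2 * (a\<^sup>2 * v) * min 1 (\<bar>a\<bar> * B)"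
    using 1 norm_triangle_sub[of "char (distr M borel X) a - complex_of_real (exp (- b))" "char (distr M borel X) a - (1 - a\<^sup>2 * v / 2)"]
    by (simp add: b_def)
  then show ?thesis unfolding 2 by (simp add: b_def v_def X_def)
qed

subsection \<open>Independent elements\<close>

lemma indep_elements_joint_distr:
  assumes M: "prob_space M" and ind: "indep_elements M S U T V"
  shows "distr M (S \<Otimes>\<^sub>M T) (\<lambda>\<omega>. (U \<omega>, V \<omega>)) = distr M S U \<Otimes>\<^sub>M distr M T V"
proof -
  interpret prob_space M by fact
  have U[measurable]: "U \<in> measurable M S" and V[measurable]: "V \<in> measurable M T"
    and indep: "indep_set {U -` A \<inter> space M |A. A \<in> sets S} {V -` B \<inter> space M |B. B \<in> sets T}"
    using ind unfolding indep_elements_def by auto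
  interpret PU: prob_space "distr M S U" by (rule prob_space_distr) (rule U)
  interpret PV: prob_space "distr M T V" by (rule prob_space_distr) (rule V)
  show ?thesis
  proof (rule pair_measure_eqI[symmetric])
    show "sigma_finite_measure (distr M S U)" ..
    show "sigma_finite_measure (distr M T V)" ..
    show "sets (distr M S U \<Otimes>\<^sub>M distr M T V) = sets (distr M (S \<Otimes>\<^sub>M T) (\<lambda>\<omega>. (U \<omega>, V \<omega>)))"
      by (simp cong: sets_pair_measure_cong)
    fix A B assume "A \<in> sets (distr M S U)" "B \<in> sets (distr M T V)"
    then have A[measurable]: "A \<in> sets S" and B[measurable]: "B \<in> sets T" by auto
    have "prob ((U -` A \<inter> space M) \<inter> (V -` B \<inter> space M)) = prob (U -` A \<inter> space M) * prob (V -` B \<inter> space M)"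
      by (rule indep_setD[OF indep]) (use A B in auto)
    moreover have "(\<lambda>\<omega>. (U \<omega>, V \<omega>)) -` (A \<times> B) \<inter> space M = (U -` A \<inter> space M) \<inter> (V -` B \<inter> space M)"
      by auto
    ultimately show "emeasure (distr M S U) A * emeasure (distr M T V) B
        = emeasure (distr M (S \<Otimes>\<^sub>M T) (\<lambda>\<omega>. (U \<omega>, V \<omega>))) (A \<times> B)"
      by (simp add: emeasure_distr emeasure_eq_measure ennreal_mult[symmetric])
  qed
qed

text \<open>Conditioning on \<open>V\<close> without conditional expectations: the joint law is a
  product, so Fubini freezes \<open>V\<close> and integrates \<open>U\<close> out first.\<close>

lemma indep_elements_integral:
  fixes \<Phi> :: "'b \<Rightarrow> 'c \<Rightarrow> 'd::{banach, second_countable_topology}"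
  assumes M: "prob_space M" and ind: "indep_elements M S U T V"
    and \<Phi>: "case_prod \<Phi> \<in> borel_measurable (S \<Otimes>\<^sub>M T)" and bd: "\<And>u v. norm (\<Phi> u v) \<le> B"
  shows "(\<integral>\<omega>. \<Phi> (U \<omega>) (V \<omega>) \<partial>M) = (\<integral>\<omega>. (\<integral>\<omega>'. \<Phi> (U \<omega>') (V \<omega>) \<partial>M) \<partial>M)"
proof -
  interpret prob_space M by fact
  have U[measurable]: "U \<in> measurable M S" and V[measurable]: "V \<in> measurable M T"
    using ind unfolding indep_elements_def by auto
  interpret PU: prob_space "distr M S U" by (rule prob_space_distr) (rule U)
  interpret PV: prob_space "distr M T V" by (rule prob_space_distr) (rule V)
  interpret P: pair_sigma_finite "distr M S U" "distr M T V" ..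
  interpret PP: prob_space "distr M S U \<Otimes>\<^sub>M distr M T V"
    by (rule prob_space_pair) (rule PU.prob_space_axioms, rule PV.prob_space_axioms)
  note [measurable] = \<Phi>
  have \<Phi>': "case_prod \<Phi> \<in> borel_measurable (distr M S U \<Otimes>\<^sub>M distr M T V)"
    using \<Phi> by (simp cong: measurable_cong_sets sets_pair_measure_cong)
  have int: "integrable (distr M S U \<Otimes>\<^sub>M distr M T V) (\<lambda>(u, v). \<Phi> u v)"
    by (rule PP.integrable_const_bound[where B = B]) (use bd \<Phi>' in \<open>auto simp: split_beta\<close>)
  have "(\<integral>\<omega>. \<Phi> (U \<omega>) (V \<omega>) \<partial>M) = (\<integral>p. case_prod \<Phi> p \<partial>distr M (S \<Otimes>\<^sub>M T) (\<lambda>\<omega>. (U \<omega>, V \<omega>)))"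
    by (subst integral_distr) auto
  also have "\<dots> = (\<integral>v. (\<integral>u. \<Phi> u v \<partial>distr M S U) \<partial>distr M T V)"
    unfolding indep_elements_joint_distr[OF M ind] by (rule P.integral_snd[OF int, symmetric, simplified])
  also have "\<dots> = (\<integral>\<omega>. (\<integral>u. \<Phi> u (V \<omega>) \<partial>distr M S U) \<partial>M)"
    by (subst integral_distr) auto
  also have "\<dots> = (\<integral>\<omega>. (\<integral>\<omega>'. \<Phi> (U \<omega>') (V \<omega>) \<partial>M) \<partial>M)"
  proof (intro Bochner_Integration.integral_cong refl)
    fix \<omega> assume "\<omega> \<in> space M"
    then have "V \<omega> \<in> space T" by (rule measurable_space[OF V])
    then have "(\<lambda>u. \<Phi> u (V \<omega>)) \<in> borel_measurable S" by measurable
    then show "(\<integral>u. \<Phi> u (V \<omega>) \<partial>distr M S U) = (\<integral>\<omega>'. \<Phi> (U \<omega>') (V \<omega>) \<partial>M)"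
      by (rule integral_distr[OF U])
  qed
  finally show ?thesis .
qed

subsection \<open>The weighted kernel sum\<close>

lemma square_integrable_add:
  fixes A B :: "'a \<Rightarrow> 'b::{real_normed_vector, second_countable_topology}"
  assumes [measurable]: "A \<in> borel_measurable M" "B \<in> borel_measurable M"
    and A: "integrable M (\<lambda>\<omega>. (norm (A \<omega>))\<^sup>2)" and B: "integrable M (\<lambda>\<omega>. (norm (B \<omega>))\<^sup>2)"
  shows "integrable M (\<lambda>\<omega>. (norm (A \<omega> + B \<omega>))\<^sup>2)"
proof (rule Bochner_Integration.integrable_bound)
  show "integrable M (\<lambda>\<omega>. 2 * (norm (A \<omega>))\<^sup>2 + 2 * (norm (B \<omega>))\<^sup>2)" using A B by simp
  show "AE \<omega> in M. norm ((norm (A \<omega> + B \<omega>))\<^sup>2) \<le> norm (2 * (norm (A \<omega>))\<^sup>2 + 2 * (norm (B \<omega>))\<^sup>2)"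
  proof (rule AE_I2)
    fix \<omega>
    have "(norm (A \<omega> + B \<omega>))\<^sup>2 \<le> (norm (A \<omega>) + norm (B \<omega>))\<^sup>2"
      by (intro power_mono norm_triangle_ineq) simp
    also have "\<dots> \<le> 2 * (norm (A \<omega>))\<^sup>2 + 2 * (norm (B \<omega>))\<^sup>2"
      using sum_squares_bound[of "norm (A \<omega>)" "norm (B \<omega>)"] by (simp add: power2_sum)
    finally show "norm ((norm (A \<omega> + B \<omega>))\<^sup>2) \<le> norm (2 * (norm (A \<omega>))\<^sup>2 + 2 * (norm (B \<omega>))\<^sup>2)"
      by simp
  qed
qed measurable

lemma square_integrable_sum:
  fixes A :: "'i \<Rightarrow> 'a \<Rightarrow> 'b::{real_normed_vector, second_countable_topology}"
  assumes "finite I" and "\<And>i. i \<in> I \<Longrightarrow> A i \<in> borel_measurable M"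
    and "\<And>i. i \<in> I \<Longrightarrow> integrable M (\<lambda>\<omega>. (norm (A i \<omega>))\<^sup>2)"
  shows "integrable M (\<lambda>\<omega>. (norm (\<Sum>i\<in>I. A i \<omega>))\<^sup>2)"
  using assms
proof (induction I rule: finite_induct)
  case (insert i I)
  then show ?case
    by (simp, intro square_integrable_add borel_measurable_sum) auto
qed simp

text \<open>The difference of the squares of the two sides is the variance of
  \<open>\<bar>Z\<bar>\<close>.\<close>

lemma (in prob_space) expectation_abs_le_sqrt:
  fixes Z :: "'a \<Rightarrow> real"
  assumes [measurable]: "random_variable borel Z" and Z2: "integrable M (\<lambda>\<omega>. (Z \<omega>)\<^sup>2)"
  shows "integrable M Z" and "expectation (\<lambda>\<omega>. \<bar>Z \<omega>\<bar>) \<le> sqrt (expectation (\<lambda>\<omega>. (Z \<omega>)\<^sup>2))"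
proof -
  show Z: "integrable M Z" by (rule square_integrable_imp_integrable[OF _ Z2]) simp
  have "0 \<le> variance (\<lambda>\<omega>. \<bar>Z \<omega>\<bar>)" by simp
  also have "\<dots> = expectation (\<lambda>\<omega>. (Z \<omega>)\<^sup>2) - (expectation (\<lambda>\<omega>. \<bar>Z \<omega>\<bar>))\<^sup>2"
    using Z Z2 by (subst variance_eq) auto
  finally show "expectation (\<lambda>\<omega>. \<bar>Z \<omega>\<bar>) \<le> sqrt (expectation (\<lambda>\<omega>. (Z \<omega>)\<^sup>2))"
    by (intro real_le_rsqrt) simp
qed

text \<open>By stationarity the mean of \<open>Y 1\<close> is also that of the sample mean, so the
  covariance matrix is the second moment matrix of the deviation. The first absolute moment is then
  bounded by the root of its quadratic form at \<open>t\<close>.\<close>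

lemma expectation_sample_mean_deviation_le:
  fixes Y :: "int \<Rightarrow> 'a \<Rightarrow> real ^ 'n"
  assumes M: "prob_space M" and stat: "stationary M Y"
    and Y2: "integrable M (\<lambda>\<omega>. (norm (Y 1 \<omega>))\<^sup>2)" and n: "n \<ge> 1"
  shows "(\<integral>\<omega>. \<bar>t \<bullet> (sample_mean Y n \<omega> - (\<integral>\<omega>'. Y 1 \<omega>' \<partial>M))\<bar> \<partial>M)
      \<le> sqrt (lambda_max (cov_matrix M (sample_mean Y n)) * (norm t)\<^sup>2)"
    and "integrable M (\<lambda>\<omega>. \<bar>t \<bullet> (sample_mean Y n \<omega> - (\<integral>\<omega>'. Y 1 \<omega>' \<partial>M))\<bar>)"
proof -
  interpret prob_space M by fact
  have Y[measurable]: "Y i \<in> borel_measurable M" for i using stat by (simp add: stationary_def)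
  let ?\<mu> = "\<integral>\<omega>'. Y 1 \<omega>' \<partial>M"
  have Yi2: "integrable M (\<lambda>\<omega>. (norm (Y i \<omega>))\<^sup>2)" for i
    using stationary_integral(2)[OF stat, of "\<lambda>y. (norm y)\<^sup>2" i 1] Y2 by simp
  have "integrable M (\<lambda>\<omega>. norm (Y i \<omega>))" for i
    by (rule square_integrable_imp_integrable[OF _ Yi2]) simp
  then have Yi: "integrable M (Y i)" for i by (simp add: integrable_norm_iff)
  have EY: "(\<integral>\<omega>. Y (int i) \<omega> \<partial>M) = ?\<mu>" for i
    by (rule stationary_integral(1)[OF stat, of "\<lambda>y. y"]) simp
  have Em: "(\<integral>\<omega>. sample_mean Y n \<omega> \<partial>M) = ?\<mu>"
    unfolding sample_mean_def using n
    by (simp add: Bochner_Integration.integral_sum Yi EY sum_constant_scaleR del: sum_constant)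
  have [measurable]: "sample_mean Y n \<in> borel_measurable M" unfolding sample_mean_def[abs_def] by measurable
  define Z where "Z \<omega> = sample_mean Y n \<omega> - ?\<mu>" for \<omega>
  have Zm[measurable]: "Z \<in> borel_measurable M" unfolding Z_def[abs_def] by measurable
  have Z2: "integrable M (\<lambda>\<omega>. (norm (Z \<omega>))\<^sup>2)"
  proof -
    have s: "integrable M (\<lambda>\<omega>. (norm (\<Sum>i=1..n. Y (int i) \<omega>))\<^sup>2)"
      by (rule square_integrable_sum) (auto intro: Yi2)
    have "(norm (sample_mean Y n \<omega>))\<^sup>2 = (1 / real n)\<^sup>2 * (norm (\<Sum>i=1..n. Y (int i) \<omega>))\<^sup>2" for \<omega>
      unfolding sample_mean_def by (simp add: power_divide)
    then have "integrable M (\<lambda>\<omega>. (norm (sample_mean Y n \<omega>))\<^sup>2)"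
      using s by simp
    then have "integrable M (\<lambda>\<omega>. (norm (sample_mean Y n \<omega> + - ?\<mu>))\<^sup>2)"
      by (intro square_integrable_add) auto
    then show ?thesis by (simp add: Z_def)
  qed
  have cov: "cov_matrix M (sample_mean Y n) = second_moment_matrix M Z"
    unfolding cov_matrix_def Em Z_def ..
  have m: "(\<lambda>\<omega>. t \<bullet> Z \<omega>) \<in> borel_measurable M" by measurable
  note iz = integrable_inner_squared[OF Zm Z2, of t]
  have "expectation (\<lambda>\<omega>. \<bar>t \<bullet> Z \<omega>\<bar>) \<le> sqrt (expectation (\<lambda>\<omega>. (t \<bullet> Z \<omega>)\<^sup>2))"
    by (rule expectation_abs_le_sqrt(2)[OF m iz])
  also have "\<dots> \<le> sqrt (lambda_max (second_moment_matrix M Z) * (norm t)\<^sup>2)"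
    unfolding second_moment_quadratic_form[OF Zm Z2, symmetric]
    by (intro real_sqrt_le_mono quadratic_form_le_lambda_max transpose_second_moment_matrix[OF Zm Z2])
  finally show "(\<integral>\<omega>. \<bar>t \<bullet> (sample_mean Y n \<omega> - ?\<mu>)\<bar> \<partial>M)
      \<le> sqrt (lambda_max (cov_matrix M (sample_mean Y n)) * (norm t)\<^sup>2)"
    unfolding cov Z_def .
  show "integrable M (\<lambda>\<omega>. \<bar>t \<bullet> (sample_mean Y n \<omega> - ?\<mu>)\<bar>)"
    using expectation_abs_le_sqrt(1)[OF m iz] unfolding Z_def by (rule integrable_abs)
qed

text \<open>With the path of \<open>Y\<close> frozen, the coefficients are constants and
  independence of the \<open>X i\<close> splits the exponential into a product; the common density
  then replaces each \<open>X i\<close> by \<open>X 1\<close>.\<close>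

lemma char_weighted_sum_factorization:
  fixes X :: "nat \<Rightarrow> 'a \<Rightarrow> real" and Y :: "int \<Rightarrow> 'a \<Rightarrow> real ^ 'n" and G :: "real \<Rightarrow> real"
  assumes M: "prob_space M" and iv: "prob_space.indep_vars M (\<lambda>_. borel) X {1..}"
    and dens: "\<And>i. i \<ge> 1 \<Longrightarrow> distributed M lborel (X i) (\<lambda>x. ennreal (f x))"
    and ie: "indep_elements M
        (Pi\<^sub>M {1..} (\<lambda>_. borel)) (\<lambda>\<omega>. \<lambda>i\<in>{1..}. X i \<omega>) (Pi\<^sub>M UNIV (\<lambda>_. borel)) (\<lambda>\<omega> i. Y i \<omega>)"
    and G[measurable]: "G \<in> borel_measurable borel"
  shows "(CLINT \<omega>|M. iexp (\<Sum>i=1..n. a * (t \<bullet> Y (int i) \<omega>) * G (X i \<omega>)))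
    = (CLINT \<omega>|M. \<Prod>i=1..n. CLINT \<omega>'|M. iexp (a * (t \<bullet> Y (int i) \<omega>) * G (X 1 \<omega>')))"
proof -
  interpret prob_space M by fact
  have X: "X i \<in> borel_measurable M" if "i \<ge> 1" for i
    using distributed_measurable[OF dens[OF that]] by simp
  let ?S = "Pi\<^sub>M {1..} (\<lambda>_::nat. borel :: real measure)" and ?T = "Pi\<^sub>M UNIV (\<lambda>_::int. borel :: (real ^ 'n) measure)"
  define \<Phi> where "\<Phi> u y = iexp (\<Sum>i=1..n. a * (t \<bullet> y (int i)) * G (u i))" for u :: "nat \<Rightarrow> real" and y :: "int \<Rightarrow> real ^ 'n"
  have um: "(\<lambda>p. fst p i) \<in> borel_measurable (?S \<Otimes>\<^sub>M ?T)" if "i \<in> {1..n}" for i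
    by (rule measurable_compose[OF measurable_fst measurable_component_singleton]) (use that in simp)
  have ym: "(\<lambda>p. snd p i) \<in> borel_measurable (?S \<Otimes>\<^sub>M ?T)" for i
    by (rule measurable_compose[OF measurable_snd measurable_component_singleton]) simp
  have summand: "(\<lambda>p. a * (t \<bullet> snd p (int i)) * G (fst p i)) \<in> borel_measurable (?S \<Otimes>\<^sub>M ?T)" if "i \<in> {1..n}" for i
    using um[OF that] ym[of "int i"] by measurable
  have "(\<lambda>p. \<Sum>i=1..n. a * (t \<bullet> snd p (int i)) * G (fst p i)) \<in> borel_measurable (?S \<Otimes>\<^sub>M ?T)"
    by (rule borel_measurable_sum) (rule summand)
  then have \<Phi>m: "case_prod \<Phi> \<in> borel_measurable (?S \<Otimes>\<^sub>M ?T)"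
    unfolding \<Phi>_def split_beta by measurable
  have "(CLINT \<omega>|M. iexp (\<Sum>i=1..n. a * (t \<bullet> Y (int i) \<omega>) * G (X i \<omega>)))
      = (CLINT \<omega>|M. \<Phi> (\<lambda>i\<in>{1..}. X i \<omega>) (\<lambda>i. Y i \<omega>))"
    unfolding \<Phi>_def by (intro Bochner_Integration.integral_cong refl arg_cong[where f = iexp] sum.cong) auto
  also have "\<dots> = (CLINT \<omega>|M. CLINT \<omega>'|M. \<Phi> (\<lambda>i\<in>{1..}. X i \<omega>') (\<lambda>i. Y i \<omega>))"
    by (rule indep_elements_integral[OF M ie \<Phi>m, of 1]) (simp add: \<Phi>_def)
  also have "\<dots> = (CLINT \<omega>|M. \<Prod>i=1..n. CLINT \<omega>'|M. iexp (a * (t \<bullet> Y (int i) \<omega>) * G (X 1 \<omega>')))"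
  proof (intro Bochner_Integration.integral_cong refl)
    fix \<omega>
    define w where "w i = a * (t \<bullet> Y (int i) \<omega>)" for i
    have "(CLINT \<omega>'|M. \<Phi> (\<lambda>i\<in>{1..}. X i \<omega>') (\<lambda>i. Y i \<omega>)) = (CLINT \<omega>'|M. \<Prod>i=1..n. iexp (w i * G (X i \<omega>')))"
      unfolding \<Phi>_def w_def
      by (intro Bochner_Integration.integral_cong refl) (simp add: exp_sum[symmetric] sum_distrib_left)
    also have "\<dots> = (\<Prod>i=1..n. CLINT \<omega>'|M. iexp (w i * G (X i \<omega>')))"
    proof (rule indep_vars_lebesgue_integral)
      have "indep_vars (\<lambda>_. borel) X {1..n}" by (rule indep_vars_subset[OF iv]) auto
      then show "indep_vars (\<lambda>_. borel) (\<lambda>i \<omega>'. iexp (w i * G (X i \<omega>'))) {1..n}"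
        by (rule indep_vars_compose2[where Y = "\<lambda>i x. iexp (w i * G x)"]) measurable
      show "integrable M (\<lambda>\<omega>'. iexp (w i * G (X i \<omega>')))" if "i \<in> {1..n}" for i
        using X[of i] that by (intro integrable_iexp) (auto intro!: borel_measurable_times measurable_compose[OF _ G])
    qed simp
    also have "\<dots> = (\<Prod>i=1..n. CLINT \<omega>'|M. iexp (w i * G (X 1 \<omega>')))"
    proof (rule prod.cong[OF refl])
      fix i assume i: "i \<in> {1..n}"
      have "(CLINT \<omega>'|M. iexp (w i * G (X j \<omega>'))) = (CLINT x|density lborel (\<lambda>x. ennreal (f x)). iexp (w i * G x))"
        if "j \<ge> 1" for j
        unfolding distributed_distr_eq_density[OF dens[OF that], symmetric]
        by (subst integral_distr) (use X[OF that] in auto)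
      then show "(CLINT \<omega>'|M. iexp (w i * G (X i \<omega>'))) = (CLINT \<omega>'|M. iexp (w i * G (X 1 \<omega>')))"
        using i by simp
    qed
    finally show "(CLINT \<omega>'|M. \<Phi> (\<lambda>i\<in>{1..}. X i \<omega>') (\<lambda>i. Y i \<omega>))
        = (\<Prod>i=1..n. CLINT \<omega>'|M. iexp (a * (t \<bullet> Y (int i) \<omega>) * G (X 1 \<omega>')))" unfolding w_def .
  qed
  finally show ?thesis .
qed

text \<open>Two products of factors of modulus at most 1 differ by at most the sum of the factorwise
  differences. Stationarity gives all \<open>n\<close> error terms the same expectation.\<close>

lemma char_product_gaussian_approx:
  fixes Y :: "int \<Rightarrow> 'a \<Rightarrow> real ^ 'n" and Z :: "'a \<Rightarrow> real"
  assumes M: "prob_space M" and stat: "stationary M Y"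
    and Y2: "integrable M (\<lambda>\<omega>. (norm (Y 1 \<omega>))\<^sup>2)"
    and Z[measurable]: "Z \<in> borel_measurable M" and bd: "\<And>\<omega>. \<omega> \<in> space M \<Longrightarrow> 0 \<le> Z \<omega> \<and> Z \<omega> \<le> B"
    and v: "v = (\<integral>\<omega>. (Z \<omega> - (\<integral>\<omega>'. Z \<omega>' \<partial>M))\<^sup>2 \<partial>M)"
  shows "cmod ((CLINT \<omega>|M. \<Prod>i=1..n. CLINT \<omega>'|M. iexp (a * (t \<bullet> Y (int i) \<omega>) * (Z \<omega>' - (\<integral>\<omega>''. Z \<omega>'' \<partial>M))))
      - (CLINT \<omega>|M. complex_of_real (exp (- (a\<^sup>2 * v * (\<Sum>i=1..n. (t \<bullet> Y (int i) \<omega>)\<^sup>2) / 2)))))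
    \<le> 2 * (real n * a\<^sup>2 * v) * (\<integral>\<omega>. (t \<bullet> Y 1 \<omega>)\<^sup>2 * min 1 (\<bar>a * (t \<bullet> Y 1 \<omega>)\<bar> * B) \<partial>M)"
proof -
  interpret prob_space M by fact
  have Y[measurable]: "Y i \<in> borel_measurable M" for i using stat by (simp add: stationary_def)
  define \<xi> where "\<xi> b = (CLINT \<omega>'|M. iexp (b * (Z \<omega>' - expectation Z)))" for b
  have \<xi>m[measurable]: "\<xi> \<in> borel_measurable borel" unfolding \<xi>_def[abs_def] by measurable
  have \<xi>1: "cmod (\<xi> b) \<le> 1" for b
  proof -
    have "cmod (\<xi> b) \<le> (\<integral>\<omega>'. cmod (iexp (b * (Z \<omega>' - expectation Z))) \<partial>M)"
      unfolding \<xi>_def by (rule integral_norm_bound)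
    then show ?thesis by (simp add: prob_space)
  qed
  define W where "W i \<omega> = t \<bullet> Y (int i) \<omega>" for i \<omega>
  have [measurable]: "W i \<in> borel_measurable M" for i unfolding W_def[abs_def] by measurable
  have v0: "0 \<le> v" unfolding v by simp
  have B0: "0 \<le> B" using bd not_empty by fastforce
  define g where "g b = exp (- (b\<^sup>2 * v / 2))" for b
  have [measurable]: "g \<in> borel_measurable borel" unfolding g_def[abs_def] by measurable
  have g1: "0 \<le> g b" "g b \<le> 1" for b using v0 by (auto simp: g_def)
  define \<psi> where "\<psi> y = (t \<bullet> y)\<^sup>2 * min 1 (\<bar>a * (t \<bullet> y)\<bar> * B)" for y
  have [measurable]: "\<psi> \<in> borel_measurable borel" unfolding \<psi>_def[abs_def] by measurable
  have i1: "integrable M (\<lambda>\<omega>. \<psi> (Y 1 \<omega>))"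
    by (rule Bochner_Integration.integrable_bound[OF integrable_inner_squared[OF Y Y2, of t]])
       (use B0 in \<open>auto simp: \<psi>_def abs_mult intro!: mult_left_le\<close>)
  have ii: "integrable M (\<lambda>\<omega>. \<psi> (Y i \<omega>))" for i
    using i1 stationary_integral(2)[OF stat, of \<psi> i 1] by simp
  have Ei: "expectation (\<lambda>\<omega>. \<psi> (Y (int i) \<omega>)) = expectation (\<lambda>\<omega>. \<psi> (Y 1 \<omega>))" for i
    by (rule stationary_integral(1)[OF stat]) simp
  have pt: "cmod ((\<Prod>i=1..n. \<xi> (a * W i \<omega>)) - (\<Prod>i=1..n. complex_of_real (g (a * W i \<omega>))))
      \<le> (\<Sum>i=1..n. 2 * (a\<^sup>2 * v) * \<psi> (Y (int i) \<omega>))" for \<omega>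
  proof -
    have "cmod ((\<Prod>i=1..n. \<xi> (a * W i \<omega>)) - (\<Prod>i=1..n. complex_of_real (g (a * W i \<omega>))))
        \<le> (\<Sum>i=1..n. cmod (\<xi> (a * W i \<omega>) - complex_of_real (g (a * W i \<omega>))))"
      by (rule norm_prod_diff) (use \<xi>1 g1 in auto)
    also have "\<dots> \<le> (\<Sum>i=1..n. 2 * (a\<^sup>2 * v) * \<psi> (Y (int i) \<omega>))"
    proof (rule sum_mono)
      fix i
      have "cmod (\<xi> (a * W i \<omega>) - complex_of_real (g (a * W i \<omega>)))
          \<le> 2 * ((a * W i \<omega>)\<^sup>2 * v) * min 1 (\<bar>a * W i \<omega>\<bar> * B)"
        unfolding \<xi>_def g_def v by (rule char_centered_approx_exp[OF Z bd])
      then show "cmod (\<xi> (a * W i \<omega>) - complex_of_real (g (a * W i \<omega>))) \<le> 2 * (a\<^sup>2 * v) * \<psi> (Y (int i) \<omega>)"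
        by (simp add: \<psi>_def W_def power_mult_distrib mult_ac)
    qed
    finally show ?thesis .
  qed
  have gprod: "(\<Prod>i=1..n. complex_of_real (g (a * W i \<omega>)))
      = complex_of_real (exp (- (a\<^sup>2 * v * (\<Sum>i=1..n. (W i \<omega>)\<^sup>2) / 2)))" for \<omega>
    unfolding g_def of_real_prod[symmetric]
    by (simp add: exp_sum[symmetric] sum_negf[symmetric] sum_distrib_left sum_divide_distrib power_mult_distrib mult_ac
        del: of_real_exp)
  have int1: "integrable M (\<lambda>\<omega>. \<Prod>i=1..n. \<xi> (a * W i \<omega>))"
    by (rule integrable_const_bound[where B = 1]) (auto simp: prod_norm[symmetric] intro!: prod_le_1 \<xi>1)
  have int2: "integrable M (\<lambda>\<omega>. \<Prod>i=1..n. complex_of_real (g (a * W i \<omega>)))"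
    by (rule integrable_const_bound[where B = 1]) (auto simp: prod_norm[symmetric] g1 intro!: prod_le_1)
  have "cmod ((CLINT \<omega>|M. \<Prod>i=1..n. \<xi> (a * W i \<omega>)) - (CLINT \<omega>|M. \<Prod>i=1..n. complex_of_real (g (a * W i \<omega>))))
      = cmod (CLINT \<omega>|M. (\<Prod>i=1..n. \<xi> (a * W i \<omega>)) - (\<Prod>i=1..n. complex_of_real (g (a * W i \<omega>))))"
    using int1 int2 by simp
  also have "\<dots> \<le> (\<integral>\<omega>. cmod ((\<Prod>i=1..n. \<xi> (a * W i \<omega>)) - (\<Prod>i=1..n. complex_of_real (g (a * W i \<omega>)))) \<partial>M)"
    by (rule integral_norm_bound)
  also have "\<dots> \<le> (\<integral>\<omega>. (\<Sum>i=1..n. 2 * (a\<^sup>2 * v) * \<psi> (Y (int i) \<omega>)) \<partial>M)"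
    by (rule integral_mono) (intro integrable_norm Bochner_Integration.integrable_diff int1 int2
        Bochner_Integration.integrable_sum integrable_mult_right ii pt)+
  also have "\<dots> = 2 * (real n * a\<^sup>2 * v) * expectation (\<lambda>\<omega>. \<psi> (Y 1 \<omega>))"
    using ii by (simp add: Bochner_Integration.integral_sum Ei mult_ac)
  finally show ?thesis unfolding gprod unfolding \<xi>_def W_def \<psi>_def .
qed

theorem theorem2p1:
  fixes M :: "'a measure"
    and Y :: "int \<Rightarrow> 'a \<Rightarrow> real ^ 's"
    and X :: "nat \<Rightarrow> 'a \<Rightarrow> real"
    and f K :: "real \<Rightarrow> real"
    and h :: "nat \<Rightarrow> real"
  assumes "prob_space M"
    and "stationary M Y" and "ergodic M Y"
    and "integrable M (\<lambda>\<omega>. (norm (Y 1 \<omega>))\<^sup>2)"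
    and "prob_space.indep_vars M (\<lambda>_. borel) X {1..}"
    and "\<And>i. i \<ge> 1 \<Longrightarrow> distributed M lborel (X i) (\<lambda>x. ennreal (f x))"
    and "indep_elements M
           (Pi\<^sub>M {1..} (\<lambda>_. borel)) (\<lambda>\<omega>. \<lambda>i\<in>{1..}. X i \<omega>)
           (Pi\<^sub>M UNIV (\<lambda>_. borel)) (\<lambda>\<omega> i. Y i \<omega>)"
    and "\<And>x. f x \<ge> 0" and "bounded (range f)" and "isCont f 0" and "f 0 > 0"
    and "\<And>u. K u \<ge> 0" and "integrable lborel K" and "(\<integral>u. K u \<partial>lborel) = 1"
    and "\<And>u. K (- u) = K u" and "bounded (range K)"
    and "integrable lborel (\<lambda>u. (K u)\<^sup>2)"
    and "\<And>n. n \<ge> 1 \<Longrightarrow> h n > 0" and "h \<longlonglongrightarrow> 0"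
    and "filterlim (\<lambda>n. real n * h n) at_top sequentially"
    and "(\<lambda>n. real n * h n * lambda_max (cov_matrix M (sample_mean Y n))) \<longlonglongrightarrow> 0"
  shows "weakly_converges
           (\<lambda>n. distr M borel (\<lambda>\<omega>. sqrt (real n * h n) *\<^sub>R (r_hat M K h X Y n \<omega> - (\<integral>\<omega>'. Y 1 \<omega>' \<partial>M))))
           (multivariate_normal 0
              (((\<integral>u. (K u)\<^sup>2 \<partial>lborel) / f 0) *\<^sub>R second_moment_matrix M (Y 1)))"
proof -
  interpret prob_space M by fact
  have Y[measurable]: "Y i \<in> borel_measurable M" for i using assms(2) by (simp add: stationary_def)
  have X: "X i \<in> borel_measurable M" if "i \<ge> 1" for i
    using distributed_measurable[OF assms(6)[OF that]] by simp
  have Km[measurable]: "K \<in> borel_measurable borel" using assms(13) by simp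
  have XKm: "(\<lambda>\<omega>. K (X i \<omega> / h n)) \<in> borel_measurable M" if "i \<ge> 1" for i n
    by (rule measurable_compose[OF X[OF that], of "\<lambda>x. K (x / h n)"]) measurable
  have fm[measurable]: "f \<in> borel_measurable borel"
    using distributed_real_measurable[OF _ assms(6)[of 1]] assms(8) by simp
  obtain B where KB: "\<And>u. K u \<le> B" using assms(16) unfolding bounded_iff by (auto simp: abs_le_iff)
  have h0: "eventually (\<lambda>n. h n > 0) sequentially"
    using eventually_ge_at_top[of "1::nat"] by eventually_elim (rule assms(18))

  define \<mu> where "\<mu> = (\<integral>\<omega>. Y 1 \<omega> \<partial>M)"
  define c where "c = (\<integral>u. (K u)\<^sup>2 \<partial>lborel)"
  define Z where "Z n \<omega> = K (X 1 \<omega> / h n)" for n \<omega>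
  define e where "e n = (\<integral>\<omega>. Z n \<omega> \<partial>M)" for n
  define v where "v n = (\<integral>\<omega>. (Z n \<omega> - e n)\<^sup>2 \<partial>M)" for n
  \<comment> \<open>The scaling \<open>sqrt (n h)\<close> of the theorem times the normalisation
    \<open>1 / (n e)\<close> inside \<open>r_hat\<close>.\<close>
  define \<kappa> where "\<kappa> n = sqrt (real n * h n) / (real n * e n)" for n
  have Zm[measurable]: "Z n \<in> borel_measurable M" for n unfolding Z_def[abs_def] by (rule XKm) simp
  have Zb: "0 \<le> Z n \<omega> \<and> Z n \<omega> \<le> B" for n \<omega> using assms(12) KB by (simp add: Z_def)
  have iZ: "integrable M (Z n)" for n by (rule integrable_const_bound[where B = B]) (use Zb in auto)
  have iZ2: "integrable M (\<lambda>\<omega>. (Z n \<omega>)\<^sup>2)" for n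
    by (rule integrable_const_bound[where B = "B\<^sup>2"]) (use Zb in \<open>auto intro!: power_mono\<close>)

  \<comment> \<open>Asymptotics of the kernel moments and of the scaling factor\<close>
  have e_lim: "(\<lambda>n. e n / h n) \<longlonglongrightarrow> f 0"
  proof -
    have "e n = (\<integral>x. f x * K (x / h n) \<partial>lborel)" for n
      unfolding e_def Z_def by (rule distributed_integral[OF assms(6), symmetric]) (auto simp: assms(8))
    then show ?thesis
      using rescaled_kernel_integral_converges[OF fm assms(9,10,13) h0 assms(19)] assms(14) by simp
  qed
  have q_lim: "(\<lambda>n. (\<integral>\<omega>. (Z n \<omega>)\<^sup>2 \<partial>M) / h n) \<longlonglongrightarrow> f 0 * c"
  proof -
    have "(\<integral>\<omega>. (Z n \<omega>)\<^sup>2 \<partial>M) = (\<integral>x. f x * (K (x / h n))\<^sup>2 \<partial>lborel)" for n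
      unfolding Z_def by (rule distributed_integral[OF assms(6), symmetric]) (auto simp: assms(8))
    then show ?thesis
      using rescaled_kernel_integral_converges[OF fm assms(9,10,17) h0 assms(19)] by (simp add: c_def)
  qed
  have v_eq: "v n = (\<integral>\<omega>. (Z n \<omega>)\<^sup>2 \<partial>M) - (e n)\<^sup>2" for n
    unfolding v_def e_def by (rule variance_eq[OF iZ iZ2])
  \<comment> \<open>At \<open>n = 0\<close> or \<open>e n = 0\<close> the normalising factor in
    \<open>r_hat\<close> is 0 by the convention for division, and the splitting used below may fail.
    Positivity of \<open>f 0\<close> confines this to finitely many \<open>n\<close>.\<close>
  have e_pos: "eventually (\<lambda>n. n \<ge> 1 \<and> h n > 0 \<and> e n > 0) sequentially"
    using order_tendstoD(1)[OF e_lim assms(11)] h0 eventually_ge_at_top[of "1::nat"]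
    by eventually_elim (simp add: zero_less_divide_iff)
  have v_lim: "(\<lambda>n. real n * (\<kappa> n)\<^sup>2 * v n) \<longlonglongrightarrow> c / f 0"
  proof -
    \<comment> \<open>Here \<open>n \<kappa>^2 v = h v / e^2\<close>, with numerator and denominator
      divided by \<open>h^2\<close>. The squared mean contributes \<open>(e / h)^2 * h\<close>,
      which vanishes because \<open>h\<close> tends to 0.\<close>
    have "(\<lambda>n. ((\<integral>\<omega>. (Z n \<omega>)\<^sup>2 \<partial>M) / h n - (e n / h n) * (e n / h n) * h n) / ((e n / h n) * (e n / h n)))
        \<longlonglongrightarrow> (f 0 * c - f 0 * f 0 * 0) / (f 0 * f 0)"
      by (intro tendsto_intros q_lim e_lim assms(19)) (use assms(11) in simp)
    moreover have "eventually (\<lambda>n. ((\<integral>\<omega>. (Z n \<omega>)\<^sup>2 \<partial>M) / h n - (e n / h n) * (e n / h n) * h n) / ((e n / h n) * (e n / h n))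
        = real n * (\<kappa> n)\<^sup>2 * v n) sequentially"
      using e_pos
    proof eventually_elim
      case (elim n)
      have "(\<kappa> n)\<^sup>2 = h n / (real n * (e n)\<^sup>2)"
        using elim by (simp add: \<kappa>_def power_divide power_mult_distrib power2_eq_square)
      then show ?case using elim by (simp add: v_eq power2_eq_square field_simps)
    qed
    ultimately have "(\<lambda>n. real n * (\<kappa> n)\<^sup>2 * v n) \<longlonglongrightarrow> (f 0 * c - f 0 * f 0 * 0) / (f 0 * f 0)"
      by (rule Lim_transform_eventually)
    then show ?thesis using assms(11) by simp
  qed
  have \<kappa>_lim: "\<kappa> \<longlonglongrightarrow> 0"
  proof -
    have "filterlim (\<lambda>n. sqrt (real n * h n)) at_top sequentially"
      by (rule filterlim_compose[OF sqrt_at_top assms(20)])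
    \<comment> \<open>\<open>\<kappa>\<close> equals \<open>(h / e) / sqrt (n h)\<close>: a bounded
      factor times one that vanishes because \<open>n h\<close> diverges.\<close>
    then have "(\<lambda>n. inverse (e n / h n) * inverse (sqrt (real n * h n))) \<longlonglongrightarrow> inverse (f 0) * 0"
      by (intro tendsto_mult tendsto_inverse e_lim tendsto_inverse_0_at_top) (use assms(11) in auto)
    moreover have "eventually (\<lambda>n. inverse (e n / h n) * inverse (sqrt (real n * h n)) = \<kappa> n) sequentially"
      using e_pos
    proof eventually_elim
      case (elim n)
      have "sqrt (real n * h n) * sqrt (real n * h n) = real n * h n" using elim by simp
      then show ?case using elim by (simp add: \<kappa>_def field_simps)
    qed
    ultimately show ?thesis using Lim_transform_eventually by fastforce
  qed

  \<comment> \<open>The limit covariance and convergence of the characteristic functions\<close>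
  define S where "S = (c / f 0) *\<^sub>R second_moment_matrix M (Y 1)"
  have Squad: "t \<bullet> (S *v t) = c / f 0 * (\<integral>\<omega>. (t \<bullet> Y 1 \<omega>)\<^sup>2 \<partial>M)" for t
    unfolding S_def scaleR_matrix_vector_assoc[symmetric]
    by (simp add: second_moment_quadratic_form[OF Y assms(4)])
  have c0: "0 \<le> c" by (simp add: c_def)
  have Ssym: "transpose S = S"
    using transpose_second_moment_matrix[OF Y assms(4)]
    by (simp add: S_def transpose_def vec_eq_iff)
  have Spsd: "0 \<le> t \<bullet> (S *v t)" for t using c0 assms(11) by (simp add: Squad)

  define T where "T n \<omega> = sqrt (real n * h n) *\<^sub>R (r_hat M K h X Y n \<omega> - \<mu>)" for n \<omega>
  have Tm[measurable]: "T n \<in> borel_measurable M" for n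
  proof -
    have "(\<lambda>\<omega>. K (X i \<omega> / h n) *\<^sub>R Y (int i) \<omega>) \<in> borel_measurable M" if "i \<in> {1..n}" for i
      using XKm[of i n] that by (intro borel_measurable_scaleR Y) auto
    then have "(\<lambda>\<omega>. \<Sum>i=1..n. K (X i \<omega> / h n) *\<^sub>R Y (int i) \<omega>) \<in> borel_measurable M"
      by (rule borel_measurable_sum)
    then show ?thesis unfolding T_def[abs_def] r_hat_def by measurable
  qed
  have "weakly_converges (\<lambda>n. distr M borel (T n)) (multivariate_normal 0 S)"
  proof (rule weakly_converges_if_char_vec_converges)
    show "prob_space (distr M borel (T n))" for n by (rule prob_space_distr) (rule Tm)
    show "prob_space (multivariate_normal 0 S)" by (rule prob_space_multivariate_normal[OF Ssym Spsd])
    fix t :: "real ^ 's"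
    define E where "E = (\<integral>\<omega>. (t \<bullet> Y 1 \<omega>)\<^sup>2 \<partial>M)"
    define A where "A n \<omega> = (\<Sum>i=1..n. \<kappa> n * (t \<bullet> Y (int i) \<omega>) * (K (X i \<omega> / h n) - e n))" for n \<omega>
    define D where "D n \<omega> = sqrt (real n * h n) * (t \<bullet> (sample_mean Y n \<omega> - \<mu>))" for n \<omega>
    have Am[measurable]: "A n \<in> borel_measurable M" for n
    proof -
      have "(\<lambda>\<omega>. \<kappa> n * (t \<bullet> Y (int i) \<omega>) * (K (X i \<omega> / h n) - e n)) \<in> borel_measurable M" if "i \<in> {1..n}" for i
        using XKm[of i n] that by (intro borel_measurable_times borel_measurable_diff borel_measurable_inner
            borel_measurable_const Y) auto
      then show ?thesis unfolding A_def[abs_def] by (rule borel_measurable_sum)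
    qed
    have smm[measurable]: "sample_mean Y n \<in> borel_measurable M" for n
      unfolding sample_mean_def[abs_def] by measurable
    have Dm[measurable]: "D n \<in> borel_measurable M" for n unfolding D_def[abs_def] by measurable

    \<comment> \<open>The centring terms of \<open>A n\<close> add up to
      \<open>\<kappa> * e = sqrt (n h) / n\<close> times the sum of the
      \<open>t \<bullet> Y i\<close>, which is the scaled sample mean; \<open>e n > 0\<close> is
      what allows the cancellation.\<close>
    have decomp: "t \<bullet> T n \<omega> = A n \<omega> + D n \<omega>" if "n \<ge> 1" "e n > 0" for n \<omega>
    proof -
      have "A n \<omega> = \<kappa> n * (\<Sum>i=1..n. K (X i \<omega> / h n) * (t \<bullet> Y (int i) \<omega>)) - \<kappa> n * e n * (\<Sum>i=1..n. t \<bullet> Y (int i) \<omega>)"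
        unfolding A_def by (simp add: right_diff_distrib sum_subtractf sum_distrib_left mult_ac)
      moreover have "\<kappa> n * e n = sqrt (real n * h n) / real n" using that by (simp add: \<kappa>_def)
      moreover have "D n \<omega> = sqrt (real n * h n) / real n * (\<Sum>i=1..n. t \<bullet> Y (int i) \<omega>) - sqrt (real n * h n) * (t \<bullet> \<mu>)"
        by (simp add: D_def sample_mean_def inner_diff_right inner_sum_right right_diff_distrib)
      moreover have "t \<bullet> T n \<omega> = \<kappa> n * (\<Sum>i=1..n. K (X i \<omega> / h n) * (t \<bullet> Y (int i) \<omega>)) - sqrt (real n * h n) * (t \<bullet> \<mu>)"
        unfolding T_def r_hat_def
        by (simp add: \<kappa>_def e_def Z_def inner_diff_right inner_sum_right right_diff_distrib)
      ultimately show ?thesis by simp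
    qed

    have step1: "(\<lambda>n. (CLINT \<omega>|M. iexp (t \<bullet> T n \<omega>)) - (CLINT \<omega>|M. iexp (A n \<omega>))) \<longlonglongrightarrow> 0"
    proof (rule Lim_null_comparison)
      show "eventually (\<lambda>n. cmod ((CLINT \<omega>|M. iexp (t \<bullet> T n \<omega>)) - (CLINT \<omega>|M. iexp (A n \<omega>)))
          \<le> sqrt (real n * h n * lambda_max (cov_matrix M (sample_mean Y n)) * (norm t)\<^sup>2)) sequentially"
        using e_pos
      proof eventually_elim
        case (elim n)
        note dev = expectation_sample_mean_deviation_le[OF assms(1,2,4), of n t, folded \<mu>_def]
        \<comment> \<open>The two exponentials differ by the unimodular factor
          \<open>iexp (A n \<omega>)\<close> times \<open>iexp (D n \<omega>) - 1\<close>, so the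
          absolute mean of \<open>D n\<close> controls the error whatever \<open>A n\<close>
          is.\<close>
        have "cmod (iexp (t \<bullet> T n \<omega>) - iexp (A n \<omega>)) \<le> \<bar>D n \<omega>\<bar>" for \<omega>
        proof -
          have "iexp (t \<bullet> T n \<omega>) - iexp (A n \<omega>) = iexp (A n \<omega>) * (iexp (D n \<omega>) - 1)"
            using elim by (simp add: decomp exp_add[symmetric] algebra_simps)
          then show ?thesis using iexp_approx1[of "D n \<omega>" 0] by (simp add: norm_mult)
        qed
        note pt = this
        have iD: "integrable M (\<lambda>\<omega>. \<bar>D n \<omega>\<bar>)"
          unfolding D_def abs_mult using dev(2) elim by (intro integrable_mult_right) simp
        have iT: "integrable M (\<lambda>\<omega>. iexp (t \<bullet> T n \<omega>))" by (rule integrable_iexp) measurable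
        have iA: "integrable M (\<lambda>\<omega>. iexp (A n \<omega>))" by (rule integrable_iexp) measurable
        have "cmod ((CLINT \<omega>|M. iexp (t \<bullet> T n \<omega>)) - (CLINT \<omega>|M. iexp (A n \<omega>)))
            = cmod (CLINT \<omega>|M. iexp (t \<bullet> T n \<omega>) - iexp (A n \<omega>))"
          using iT iA by simp
        also have "\<dots> \<le> (\<integral>\<omega>. cmod (iexp (t \<bullet> T n \<omega>) - iexp (A n \<omega>)) \<partial>M)"
          by (rule integral_norm_bound)
        also have "\<dots> \<le> (\<integral>\<omega>. \<bar>D n \<omega>\<bar> \<partial>M)"
          by (intro integral_mono integrable_norm Bochner_Integration.integrable_diff iT iA iD pt)
        also have "\<dots> = sqrt (real n * h n) * (\<integral>\<omega>. \<bar>t \<bullet> (sample_mean Y n \<omega> - \<mu>)\<bar> \<partial>M)"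
          using elim by (simp add: D_def abs_mult)
        also have "\<dots> \<le> sqrt (real n * h n) * sqrt (lambda_max (cov_matrix M (sample_mean Y n)) * (norm t)\<^sup>2)"
          using dev(1) elim by (intro mult_left_mono) auto
        also have "\<dots> = sqrt (real n * h n * lambda_max (cov_matrix M (sample_mean Y n)) * (norm t)\<^sup>2)"
          by (simp add: real_sqrt_mult[symmetric] mult.assoc)
        finally show ?case .
      qed
      have "(\<lambda>n. sqrt (real n * h n * lambda_max (cov_matrix M (sample_mean Y n)) * (norm t)\<^sup>2)) \<longlonglongrightarrow> sqrt (0 * (norm t)\<^sup>2)"
        by (intro tendsto_real_sqrt tendsto_mult assms(21) tendsto_const)
      then show "(\<lambda>n. sqrt (real n * h n * lambda_max (cov_matrix M (sample_mean Y n)) * (norm t)\<^sup>2)) \<longlonglongrightarrow> 0" by simp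
    qed

    let ?g = "\<lambda>n \<omega>. exp (- ((\<kappa> n)\<^sup>2 * v n * (\<Sum>i=1..n. (t \<bullet> Y (int i) \<omega>)\<^sup>2) / 2))"
    have step2: "(\<lambda>n. (CLINT \<omega>|M. iexp (A n \<omega>)) - (CLINT \<omega>|M. complex_of_real (?g n \<omega>))) \<longlonglongrightarrow> 0"
    proof (rule Lim_null_comparison)
      let ?r = "\<lambda>n. \<integral>\<omega>. (t \<bullet> Y 1 \<omega>)\<^sup>2 * min 1 (\<bar>\<kappa> n * (t \<bullet> Y 1 \<omega>)\<bar> * B) \<partial>M"
      show "eventually (\<lambda>n. cmod ((CLINT \<omega>|M. iexp (A n \<omega>)) - (CLINT \<omega>|M. complex_of_real (?g n \<omega>)))
          \<le> 2 * (real n * (\<kappa> n)\<^sup>2 * v n) * ?r n) sequentially"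
      proof (rule always_eventually, rule allI)
        fix n
        \<comment> \<open>Bandwidth and centring are both absorbed into one fixed function of
          \<open>X i\<close>, to which the factorization applies for each \<open>n\<close>.\<close>
        have Gm: "(\<lambda>x. K (x / h n) - e n) \<in> borel_measurable borel" by measurable
        have fact: "(CLINT \<omega>|M. iexp (A n \<omega>)) = (CLINT \<omega>|M. \<Prod>i=1..n.
            CLINT \<omega>'|M. iexp (\<kappa> n * (t \<bullet> Y (int i) \<omega>) * (Z n \<omega>' - e n)))"
          unfolding A_def Z_def by (rule char_weighted_sum_factorization[OF assms(1,5) _ assms(7) Gm]) (rule assms(6))
        show "cmod ((CLINT \<omega>|M. iexp (A n \<omega>)) - (CLINT \<omega>|M. complex_of_real (?g n \<omega>)))
          \<le> 2 * (real n * (\<kappa> n)\<^sup>2 * v n) * ?r n"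
          unfolding fact
          by (rule char_product_gaussian_approx[OF assms(1,2,4) Zm Zb v_def[unfolded e_def], folded e_def])
      qed
      have B0: "0 \<le> B" using Zb[of 0 undefined] by linarith
      note i2 = integrable_inner_squared[OF Y assms(4), of t]
      \<comment> \<open>The \<open>min\<close> is at most 1 and tends to 0 pointwise with
        \<open>\<kappa>\<close>, so the integrable \<open>(t \<bullet> Y 1)^2\<close> dominates; no
        higher moment of \<open>Y\<close> enters.\<close>
      have "?r \<longlonglongrightarrow> (\<integral>\<omega>. 0 \<partial>M)"
      proof (rule integral_dominated_convergence[where w = "\<lambda>\<omega>. (t \<bullet> Y 1 \<omega>)\<^sup>2"])
        show "AE \<omega> in M. norm ((t \<bullet> Y 1 \<omega>)\<^sup>2 * min 1 (\<bar>\<kappa> n * (t \<bullet> Y 1 \<omega>)\<bar> * B)) \<le> (t \<bullet> Y 1 \<omega>)\<^sup>2" for n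
          using B0 by (intro AE_I2) (auto simp: abs_mult intro!: mult_left_le)
        show "AE \<omega> in M. (\<lambda>n. (t \<bullet> Y 1 \<omega>)\<^sup>2 * min 1 (\<bar>\<kappa> n * (t \<bullet> Y 1 \<omega>)\<bar> * B)) \<longlonglongrightarrow> 0"
        proof (rule AE_I2)
          fix \<omega>
          have "(\<lambda>n. (t \<bullet> Y 1 \<omega>)\<^sup>2 * min 1 (\<bar>\<kappa> n * (t \<bullet> Y 1 \<omega>)\<bar> * B)) \<longlonglongrightarrow> (t \<bullet> Y 1 \<omega>)\<^sup>2 * min 1 (\<bar>0 * (t \<bullet> Y 1 \<omega>)\<bar> * B)"
            by (intro tendsto_intros \<kappa>_lim)
          then show "(\<lambda>n. (t \<bullet> Y 1 \<omega>)\<^sup>2 * min 1 (\<bar>\<kappa> n * (t \<bullet> Y 1 \<omega>)\<bar> * B)) \<longlonglongrightarrow> 0" by simp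
        qed
      qed (use i2 in measurable)
      then have "(\<lambda>n. 2 * (real n * (\<kappa> n)\<^sup>2 * v n) * ?r n) \<longlonglongrightarrow> 2 * (c / f 0) * (\<integral>\<omega>. 0 \<partial>M)"
        by (intro tendsto_mult tendsto_const v_lim)
      then show "(\<lambda>n. 2 * (real n * (\<kappa> n)\<^sup>2 * v n) * ?r n) \<longlonglongrightarrow> 0" by simp
    qed

    have step3: "(\<lambda>n. CLINT \<omega>|M. complex_of_real (?g n \<omega>)) \<longlonglongrightarrow> complex_of_real (exp (- (c / f 0 * E / 2)))"
    proof -
      have "AE \<omega> in M. (\<lambda>n. (\<Sum>i=1..n. (t \<bullet> Y (int i) \<omega>)\<^sup>2) / real n) \<longlonglongrightarrow> E"
        unfolding E_def
        by (rule stationary_ergodic_average[OF assms(1,2,3), of "\<lambda>y. (t \<bullet> y)\<^sup>2"])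
           (simp_all add: integrable_inner_squared[OF Y assms(4)])
      then have ae: "AE \<omega> in M. (\<lambda>n. complex_of_real (?g n \<omega>)) \<longlonglongrightarrow> complex_of_real (exp (- (c / f 0 * E / 2)))"
      proof eventually_elim
        case (elim \<omega>)
        have "(\<lambda>n. complex_of_real (exp (- ((real n * (\<kappa> n)\<^sup>2 * v n) * ((\<Sum>i=1..n. (t \<bullet> Y (int i) \<omega>)\<^sup>2) / real n) / 2))))
            \<longlonglongrightarrow> complex_of_real (exp (- (c / f 0 * E / 2)))"
          by (intro tendsto_intros v_lim elim) simp
        \<comment> \<open>Splitting off \<open>real n\<close> pairs the convergent
          \<open>n \<kappa>^2 v\<close> with the ergodic average. At \<open>n = 0\<close> both sides
          are 0, the sum being empty.\<close>
        moreover have "(real n * (\<kappa> n)\<^sup>2 * v n) * ((\<Sum>i=1..n. (t \<bullet> Y (int i) \<omega>)\<^sup>2) / real n)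
            = (\<kappa> n)\<^sup>2 * v n * (\<Sum>i=1..n. (t \<bullet> Y (int i) \<omega>)\<^sup>2)" for n
          by (cases "n = 0") simp_all
        ultimately show ?case by simp
      qed
      have v0: "0 \<le> v n" for n by (simp add: v_def)
      have "(\<lambda>n. CLINT \<omega>|M. complex_of_real (?g n \<omega>)) \<longlonglongrightarrow> (CLINT \<omega>|M. complex_of_real (exp (- (c / f 0 * E / 2))))"
      proof (rule integral_dominated_convergence[where w = "\<lambda>_. 1"])
        show "AE \<omega> in M. norm (complex_of_real (?g n \<omega>)) \<le> 1" for n
          using v0 by (intro AE_I2) (simp del: of_real_exp add: sum_nonneg)
      qed (use ae in \<open>simp_all del: of_real_exp\<close>)
      then show ?thesis by (simp add: prob_space)
    qed

    \<comment> \<open>The three limits telescope: two vanishing differences plus the Gaussian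
      mixture, which converges to a constant because its random variance does.\<close>
    have "(\<lambda>n. CLINT \<omega>|M. iexp (t \<bullet> T n \<omega>)) \<longlonglongrightarrow> complex_of_real (exp (- (c / f 0 * E / 2)))"
      using tendsto_add[OF tendsto_add[OF step1 step2] step3] by simp
    moreover have "char_vec (distr M borel (T n)) t = (CLINT \<omega>|M. iexp (t \<bullet> T n \<omega>))" for n
      unfolding char_vec_def by (subst integral_distr) auto
    moreover have "char_vec (multivariate_normal 0 S) t = complex_of_real (exp (- (c / f 0 * E / 2)))"
      unfolding char_vec_multivariate_normal_0[OF Ssym Spsd] Squad E_def by simp
    ultimately show "(\<lambda>n. char_vec (distr M borel (T n)) t) \<longlonglongrightarrow> char_vec (multivariate_normal 0 S) t" by simp
  qed simp_all
  then show ?thesis unfolding T_def[abs_def] \<mu>_def S_def c_def .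
qed

end
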